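(* Let $\alpha\in(1,\infty)$ and let $\boldsymbol{\gamma}=\{\gamma_j\}_{j\in\mathbb{N}}$ be a sequence of positive real numbers with $\gamma_1\ge\gamma_2\ge\gamma_3\ge\cdots$. Monte Carlo integration in the weighted Hermite spaces $\mathcal{H}(K_{s,\alpha,\boldsymbol{\gamma}})$, $s\in\mathbb{N}$, is 1. strongly polynomially MC-tractable if and only if $\sum_{j=1}^{\infty}\max(\log(\gamma_j),0)<\infty$; 2. polynomially MC-tractable if and only if $A:=\limsup_{s\to\infty}\sum_{j=1}^{s}\frac{\max(\log(\gamma_j),0)}{\log(s)}<\infty$; 3. weakly MC-tractable if and only if $\lim_{s\to\infty}\sum_{j=1}^{s}\frac{\max(\log(\gamma_j),0)}{s}=0$.
   Context: Gaussian density: $\varphi_s(\boldsymbol{x})=(2\pi)^{-s/2}\exp(-\boldsymbol{x}\cdot\boldsymbol{x}/2)$ for $\boldsymbol{x}\in\mathbb{R}^s$, where $\cdot$ is the standard inner product. Hermite polynomials: for $k\in\mathbb{N}_0$, $H_k(x)=\frac{(-1)^k}{\sqrt{k!}}\exp(x^2/2)\frac{\mathrm{d}^k}{\mathrm{d}x^k}\exp(-x^2/2)$; for $\boldsymbol{k}=(k_1,\ldots,k_s)\in\mathbb{N}_0^s$, $H_{\boldsymbol{k}}(\boldsymbol{x})=\prod_{j=1}^sH_{k_j}(x_j)$. These form an orthonormal basis of $L^2(\mathbb{R}^s,\varphi_s)$. The $\boldsymbol{k}$th Hermite coefficient of $f$ is $\widehat f(\boldsymbol{k})=\int_{\mathbb{R}^s}f(\boldsymbol{x})H_{\boldsymbol{k}}(\boldsymbol{x})\varphi_s(\boldsymbol{x})\,\mathrm{d}\boldsymbol{x}$.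 Hermite space: for a summable $r:\mathbb{N}_0^s\to\mathbb{R}^+$, $\mathcal{H}(K_r)$ is the (real) reproducing kernel Hilbert space of functions on $\mathbb{R}^s$ with reproducing kernel $K_r(\boldsymbol{x},\boldsymbol{y})=\sum_{\boldsymbol{k}\in\mathbb{N}_0^s}r(\boldsymbol{k})H_{\boldsymbol{k}}(\boldsymbol{x})H_{\boldsymbol{k}}(\boldsymbol{y})$; its inner product is $\langle f,g\rangle_{K_r}=\sum_{\boldsymbol{k}\in\mathbb{N}_0^s}\frac{1}{r(\boldsymbol{k})}\widehat f(\boldsymbol{k})\widehat g(\boldsymbol{k})$ and its norm is $\|f\|_{K_r}=\langle f,f\rangle_{K_r}^{1/2}$. Hermite space of finite smoothness: $\mathcal{H}(K_{s,\alpha,\boldsymbol{\gamma}})$ is the Hermite space $\mathcal{H}(K_r)$ for the (summable) function $r=r_{s,\alpha,\boldsymbol{\gamma}}$, $r_{s,\alpha,\boldsymbol{\gamma}}(\boldsymbol{k})=\prod_{j=1}^sr_{\alpha,\gamma_j}(k_j)$, where $r_{\alpha,\gamma_j}(0)=1$ and $r_{\alpha,\gamma_j}(k)=\gamma_jk^{-\alpha}$ for $k\ne0$. Monte Carlo integration: $I_s(f)=\int_{\mathbb{R}^s}f(\boldsymbol{x})\varphi_s(\boldsymbol{x})\,\mathrm{d}\boldsymbol{x}$ and $\mathrm{MC}_{n,s}(\boldsymbol{x}_1,\ldots,\boldsymbol{x}_n;f)=\frac1n\sum_{i=1}^nf(\boldsymbol{x}_i)$, $n\ge1$, where $\boldsymbol{x}_1,\ldots,\boldsymbol{x}_n$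 are independent standard normally distributed random variables in $\mathbb{R}^s$. The randomized error in a Hermite space $\mathcal{H}(K_r)$ is $$e^{\mathrm{MC}}(n,s)=\sup_{f\in\mathcal{H}(K_r),\ \|f\|_{K_r}\le1}\mathbb{E}\left(\left|I_s(f)-\mathrm{MC}_{n,s}(\boldsymbol{x}_1,\ldots,\boldsymbol{x}_n;f)\right|^2\right)^{1/2},$$ and for $\varepsilon\in(0,1)$, $n^{\mathrm{MC}}(\varepsilon,s)=\min\{n\in\mathbb{N},\,n\ge1:\ e^{\mathrm{MC}}(n,s)\le\varepsilon\}$. Tractability notions (for $s\in\mathbb{N}$, $\varepsilon\in(0,1)$): - weak MC-tractability: $\lim_{s+\varepsilon^{-1}\to\infty}\frac{\log(n^{\mathrm{MC}}(\varepsilon,s))}{s+\varepsilon^{-1}}=0$; - polynomial MC-tractability: there exist positive reals $c,p,q$ with $n^{\mathrm{MC}}(\varepsilon,s)\le c\,s^q\varepsilon^{-p}$ for all $s\in\mathbb{N}$, $\varepsilon\in(0,1)$; - strong polynomial MC-tractability: there exist positive reals $c,p$ with $n^{\mathrm{MC}}(\varepsilon,s)\le c\,\varepsilon^{-p}$ for all $s\in\mathbb{N}$, $\varepsilon\in(0,1)$. *)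

theory Defs
  imports "HOL-Probability.Probability"
begin

text \<open>
  A point of \<open>\<real>\<^sup>s\<close> is a function on the index set \<open>{1..s}\<close>, extended by \<open>undefined\<close>, so that \<open>s\<close>
  can vary inside a formula; likewise for multi-indices in \<open>\<nat>\<^sub>0\<^sup>s\<close>.
\<close>

definition Rspace :: "nat \<Rightarrow> (nat \<Rightarrow> real) set" where
  "Rspace s = ({1..s} \<rightarrow>\<^sub>E UNIV)"

definition multi_index :: "nat \<Rightarrow> (nat \<Rightarrow> nat) set" where
  "multi_index s = ({1..s} \<rightarrow>\<^sub>E UNIV)"

definition leb :: "nat \<Rightarrow> (nat \<Rightarrow> real) measure" where
  "leb s = (\<Pi>\<^sub>M j\<in>{1..s}. lborel)"

definition gauss_density :: "nat \<Rightarrow> (nat \<Rightarrow> real) \<Rightarrow> real" where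
  "gauss_density s x = (2 * pi) powr (- real s / 2) * exp (- (\<Sum>j=1..s. x j * x j) / 2)"

definition std_normal :: "nat \<Rightarrow> (nat \<Rightarrow> real) measure" where
  "std_normal s = density (leb s) (\<lambda>x. ennreal (gauss_density s x))"

definition hermite :: "nat \<Rightarrow> real \<Rightarrow> real" where
  "hermite k x = (-1) ^ k / sqrt (fact k) * exp (x\<^sup>2 / 2) * (deriv ^^ k) (\<lambda>t. exp (- t\<^sup>2 / 2)) x"

definition hermite_multi :: "nat \<Rightarrow> (nat \<Rightarrow> nat) \<Rightarrow> (nat \<Rightarrow> real) \<Rightarrow> real" where
  "hermite_multi s k x = (\<Prod>j=1..s. hermite (k j) (x j))"

definition hermite_coeff :: "nat \<Rightarrow> ((nat \<Rightarrow> real) \<Rightarrow> real) \<Rightarrow> (nat \<Rightarrow> nat) \<Rightarrow> real" where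
  "hermite_coeff s f k = (LINT x|leb s. f x * hermite_multi s k x * gauss_density s x)"

text \<open>
  A Hilbert space \<open>H\<close> of real functions on \<open>X\<close> with inner product \<open>ip\<close> and reproducing kernel \<open>K\<close>.
  Functions on \<open>X\<close> are \<open>undefined\<close> outside \<open>X\<close>, so that equality in \<open>H\<close> is equality on \<open>X\<close>.
\<close>

locale rkhs =
  fixes X :: "'a set"
    and H :: "('a \<Rightarrow> real) set"
    and ip :: "('a \<Rightarrow> real) \<Rightarrow> ('a \<Rightarrow> real) \<Rightarrow> real"
    and K :: "'a \<Rightarrow> 'a \<Rightarrow> real"
  assumes extensional: "H \<subseteq> extensional X"
    and zero_closed: "(\<lambda>x\<in>X. 0) \<in> H"
    and add_closed: "\<And>f g. f \<in> H \<Longrightarrow> g \<in> H \<Longrightarrow> (\<lambda>x\<in>X. f x + g x) \<in> H"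
    and scale_closed: "\<And>c f. f \<in> H \<Longrightarrow> (\<lambda>x\<in>X. c * f x) \<in> H"
    and ip_commute: "\<And>f g. f \<in> H \<Longrightarrow> g \<in> H \<Longrightarrow> ip f g = ip g f"
    and ip_add: "\<And>f g h. f \<in> H \<Longrightarrow> g \<in> H \<Longrightarrow> h \<in> H \<Longrightarrow>
                   ip (\<lambda>x\<in>X. f x + g x) h = ip f h + ip g h"
    and ip_scale: "\<And>c f g. f \<in> H \<Longrightarrow> g \<in> H \<Longrightarrow> ip (\<lambda>x\<in>X. c * f x) g = c * ip f g"
    and ip_nonneg: "\<And>f. f \<in> H \<Longrightarrow> 0 \<le> ip f f"
    and ip_definite: "\<And>f. f \<in> H \<Longrightarrow> ip f f = 0 \<Longrightarrow> f = (\<lambda>x\<in>X. 0)"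
    and complete: "\<And>F. (\<And>n::nat. F n \<in> H) \<Longrightarrow>
         (\<And>e. 0 < e \<Longrightarrow> \<exists>N. \<forall>m\<ge>N. \<forall>n\<ge>N.
            sqrt (ip (\<lambda>x\<in>X. F m x - F n x) (\<lambda>x\<in>X. F m x - F n x)) < e) \<Longrightarrow>
         \<exists>f\<in>H. (\<lambda>n. sqrt (ip (\<lambda>x\<in>X. F n x - f x) (\<lambda>x\<in>X. F n x - f x))) \<longlonglongrightarrow> 0"
    and kernel_closed: "\<And>y. y \<in> X \<Longrightarrow> (\<lambda>x\<in>X. K x y) \<in> H"
    and reproducing: "\<And>f y. f \<in> H \<Longrightarrow> y \<in> X \<Longrightarrow> f y = ip f (\<lambda>x\<in>X. K x y)"

definition hermite_kernel ::
  "nat \<Rightarrow> ((nat \<Rightarrow> nat) \<Rightarrow> real) \<Rightarrow> (nat \<Rightarrow> real) \<Rightarrow> (nat \<Rightarrow> real) \<Rightarrow> real" where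
  "hermite_kernel s r x y =
     (\<Sum>\<^sub>\<infinity>k\<in>multi_index s. r k * hermite_multi s k x * hermite_multi s k y)"

definition hermite_inner ::
  "nat \<Rightarrow> ((nat \<Rightarrow> nat) \<Rightarrow> real) \<Rightarrow> ((nat \<Rightarrow> real) \<Rightarrow> real) \<Rightarrow> ((nat \<Rightarrow> real) \<Rightarrow> real) \<Rightarrow> real" where
  "hermite_inner s r f g =
     (\<Sum>\<^sub>\<infinity>k\<in>multi_index s. 1 / r k * hermite_coeff s f k * hermite_coeff s g k)"

definition hermite_norm ::
  "nat \<Rightarrow> ((nat \<Rightarrow> nat) \<Rightarrow> real) \<Rightarrow> ((nat \<Rightarrow> real) \<Rightarrow> real) \<Rightarrow> real" where
  "hermite_norm s r f = sqrt (hermite_inner s r f f)"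

text \<open>
  For positive summable \<open>r\<close> exactly one set of functions is a reproducing kernel Hilbert space with
  this inner product and this kernel: the \<open>f\<close> with finite norm which are the pointwise sum of their
  Hermite series.
\<close>

definition hermite_space ::
  "nat \<Rightarrow> ((nat \<Rightarrow> nat) \<Rightarrow> real) \<Rightarrow> ((nat \<Rightarrow> real) \<Rightarrow> real) set" where
  "hermite_space s r = (THE H. rkhs (Rspace s) H (hermite_inner s r) (hermite_kernel s r))"

definition finite_smoothness1 :: "real \<Rightarrow> real \<Rightarrow> nat \<Rightarrow> real" where
  "finite_smoothness1 \<alpha> g k = (if k = 0 then 1 else g * real k powr (- \<alpha>))"

definition finite_smoothness :: "real \<Rightarrow> (nat \<Rightarrow> real) \<Rightarrow> nat \<Rightarrow> (nat \<Rightarrow> nat) \<Rightarrow> real" where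
  "finite_smoothness \<alpha> \<gamma> s k = (\<Prod>j=1..s. finite_smoothness1 \<alpha> (\<gamma> j) (k j))"

definition gauss_int :: "nat \<Rightarrow> ((nat \<Rightarrow> real) \<Rightarrow> real) \<Rightarrow> real" where
  "gauss_int s f = (LINT x|leb s. f x * gauss_density s x)"

definition mc_rule :: "nat \<Rightarrow> (nat \<Rightarrow> nat \<Rightarrow> real) \<Rightarrow> ((nat \<Rightarrow> real) \<Rightarrow> real) \<Rightarrow> real" where
  "mc_rule n x f = 1 / real n * (\<Sum>i=1..n. f (x i))"

text \<open>
  The expectation is over the \<open>n\<close>-fold product of the standard normal distribution on \<open>\<real>\<^sup>s\<close>, the
  joint law of the sample points.
\<close>

definition mc_error :: "nat \<Rightarrow> ((nat \<Rightarrow> nat) \<Rightarrow> real) \<Rightarrow> nat \<Rightarrow> ereal" where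
  "mc_error s r n =
     (SUP f\<in>{f \<in> hermite_space s r. hermite_norm s r f \<le> 1}.
        ereal (sqrt (LINT x|(\<Pi>\<^sub>M i\<in>{1..n}. std_normal s). \<bar>gauss_int s f - mc_rule n x f\<bar>\<^sup>2)))"

definition n_mc :: "nat \<Rightarrow> ((nat \<Rightarrow> nat) \<Rightarrow> real) \<Rightarrow> real \<Rightarrow> nat" where
  "n_mc s r \<epsilon> = (LEAST n. 1 \<le> n \<and> mc_error s r n \<le> ereal \<epsilon>)"

text \<open>Below, \<open>r s\<close> is the weight function of the Hermite space in dimension \<open>s\<close>.\<close>

definition weakly_mc_tractable :: "(nat \<Rightarrow> (nat \<Rightarrow> nat) \<Rightarrow> real) \<Rightarrow> bool" where
  "weakly_mc_tractable r \<longleftrightarrow>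
     ((\<lambda>(s, \<epsilon>). ln (real (n_mc s (r s) \<epsilon>)) / (real s + 1 / \<epsilon>)) \<longlongrightarrow> 0)
       (inf (filtercomap (\<lambda>(s, \<epsilon>). real s + 1 / \<epsilon>) at_top) (principal ({1..} \<times> {0<..<1})))"

definition polynomially_mc_tractable :: "(nat \<Rightarrow> (nat \<Rightarrow> nat) \<Rightarrow> real) \<Rightarrow> bool" where
  "polynomially_mc_tractable r \<longleftrightarrow>
     (\<exists>c p q. 0 < c \<and> 0 < p \<and> 0 < q \<and>
        (\<forall>s\<ge>1. \<forall>\<epsilon>\<in>{0<..<1}.
           real (n_mc s (r s) \<epsilon>) \<le> c * real s powr q * \<epsilon> powr (- p)))"

definition strongly_polynomially_mc_tractable :: "(nat \<Rightarrow> (nat \<Rightarrow> nat) \<Rightarrow> real) \<Rightarrow> bool" where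
  "strongly_polynomially_mc_tractable r \<longleftrightarrow>
     (\<exists>c p. 0 < c \<and> 0 < p \<and>
        (\<forall>s\<ge>1. \<forall>\<epsilon>\<in>{0<..<1}. real (n_mc s (r s) \<epsilon>) \<le> c * \<epsilon> powr (- p)))"

end

theory Submission
  imports Defs "HOL-Computational_Algebra.Polynomial"
begin

text \<open>
  The Hermite space is a weighted sequence space, so the squared Monte Carlo error, the variance over
  \<open>n\<close>, has supremum \<open>max {r k | k \<noteq> 0} / n\<close> over the unit ball. For the weights at hand that maximum is
  \<open>\<Prod>j\<le>s. max (\<gamma> j) 1\<close> when \<open>\<gamma> 1 > 1\<close>, and at most \<open>1\<close> otherwise. Hence the required sample size lies
  between \<open>exp S\<close> and \<open>2 exp S / \<epsilon>\<^sup>2\<close>, where \<open>S = \<Sum>j\<le>s. max (ln (\<gamma> j)) 0\<close>, and each notion of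
  tractability becomes a growth condition on \<open>S\<close>.
\<close>

section \<open>Hermite polynomials\<close>

text \<open>\<open>hermite_space\<close> is a definite description, so it carries no information
  until a space with this inner product and kernel is exhibited and shown to be the only one.
  Existence rests on convergence of the kernel series at every point; for arbitrary
  \<open>\<alpha> > 1\<close> this follows once \<open>hermite k x\<close> is bounded in
  \<open>k\<close> for each fixed \<open>x\<close>, with a bound that may depend on
  \<open>x\<close>. Uniqueness has to compare two spaces neither of which is known to contain the
  other; their intersection is again such a space, and this reduces the question to an inclusion.
  The zero index drops out of the error because constants are integrated exactly, and this forces
  the case distinction on \<open>\<gamma> 1\<close>: the largest product weight is reached with
  degree 1 where \<open>\<gamma> j > 1\<close> and degree 0 elsewhere, and by monotonicity this
  index is nonzero exactly when \<open>\<gamma> 1 > 1\<close>. Otherwise \<open>S = 0\<close>, and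
  the lower bound only says that at least one sample is taken. The factor 2 in the upper bound pays
  for rounding up to an integer.\<close>

primrec hermite_poly :: "nat \<Rightarrow> real poly" where
  "hermite_poly 0 = 1"
| "hermite_poly (Suc k) = [:0, 1:] * hermite_poly k - pderiv (hermite_poly k)"

text \<open>Differentiating \<open>P(t) exp(-t^2/2)\<close> replaces \<open>P\<close> by
  \<open>P' - t P\<close>. With the sign moved into \<open>(-1)^k\<close>, this is the recursion of
  \<open>hermite_poly\<close>, which therefore yields the unnormalized probabilists'
  polynomials.\<close>

lemma iterated_deriv_gaussian:
  "(deriv ^^ k) (\<lambda>t::real. exp (- t\<^sup>2 / 2)) = (\<lambda>t. (-1) ^ k * poly (hermite_poly k) t * exp (- t\<^sup>2 / 2))"
proof (induction k)
  case (Suc k)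
  have "((\<lambda>t. (-1) ^ k * poly (hermite_poly k) t * exp (- t\<^sup>2 / 2)) has_real_derivative
      (-1) ^ Suc k * poly (hermite_poly (Suc k)) t * exp (- t\<^sup>2 / 2)) (at t)" for t :: real
  proof -
    have "((\<lambda>t. exp (- t\<^sup>2 / 2)) has_real_derivative - t * exp (- t\<^sup>2 / 2)) (at t)"
      by (auto intro!: derivative_eq_intros)
    from DERIV_mult[OF DERIV_cmult[OF poly_DERIV] this] show ?thesis
      by (rule DERIV_cong) (simp add: algebra_simps)
  qed
  then show ?case
    using Suc by (auto intro!: ext DERIV_imp_deriv)
qed simp

lemma hermite_eq_poly: "hermite k x = poly (hermite_poly k) x / sqrt (fact k)"
proof -
  have "exp (x\<^sup>2 / 2) * exp (- x\<^sup>2 / 2) = 1"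
    by (simp flip: exp_add)
  moreover have "((-1)::real) ^ k * (-1) ^ k = 1"
    by (simp flip: power_mult_distrib)
  ultimately show ?thesis
    unfolding hermite_def iterated_deriv_gaussian by (simp add: field_simps)
qed

text \<open>The Appell property. Differentiating the recursion and applying the induction hypothesis
  to both derivatives leaves a bracket that is the recursion itself one degree lower.\<close>

lemma pderiv_hermite_poly_Suc: "pderiv (hermite_poly (Suc k)) = smult (real (Suc k)) (hermite_poly k)"
proof (induction k)
  case (Suc k)
  have "pderiv (hermite_poly (Suc (Suc k))) =
      hermite_poly (Suc k) + [:0, 1:] * pderiv (hermite_poly (Suc k)) - pderiv (pderiv (hermite_poly (Suc k)))"
    by (subst hermite_poly.simps(2), subst pderiv_diff, subst pderiv_mult) (simp add: pderiv_pCons)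
  also have "\<dots> = hermite_poly (Suc k) + smult (real (Suc k)) ([:0, 1:] * hermite_poly k - pderiv (hermite_poly k))"
    unfolding Suc by (simp add: pderiv_smult smult_diff_right)
  also have "\<dots> = smult (real (Suc (Suc k))) (hermite_poly (Suc k))"
    by (simp only: of_nat_Suc[of "Suc k"] smult_add_left smult_1_left hermite_poly.simps(2)[symmetric])
  finally show ?case .
qed (simp add: pderiv_pCons)

lemma hermite_poly_rec:
  "hermite_poly (Suc (Suc k)) = [:0, 1:] * hermite_poly (Suc k) - smult (real (Suc k)) (hermite_poly k)"
  by (subst hermite_poly.simps(2)) (simp only: pderiv_hermite_poly_Suc)

text \<open>Normalization by \<open>sqrt (fact k)\<close> splits the integer coefficient of the
  polynomial recurrence into square roots on both sides. This balanced form is what makes the energy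
  in \<open>hermite_bounded\<close> telescope.\<close>

lemma hermite_rec:
  "sqrt (real k + 2) * hermite (k + 2) x = x * hermite (Suc k) x - sqrt (real k + 1) * hermite k x"
proof -
  define P where "P = (\<lambda>j. poly (hermite_poly j) x)"
  have rec: "P (Suc (Suc k)) = x * P (Suc k) - (real k + 1) * P k"
    unfolding P_def hermite_poly_rec by (simp add: algebra_simps)
  have "sqrt (real k + 2) * hermite (k + 2) x = P (Suc (Suc k)) / (sqrt (real k + 1) * sqrt (fact k))"
    by (simp add: hermite_eq_poly P_def real_sqrt_mult add_ac)
  also have "\<dots> = x * P (Suc k) / (sqrt (real k + 1) * sqrt (fact k))
      - (sqrt (real k + 1))\<^sup>2 * P k / (sqrt (real k + 1) * sqrt (fact k))"
    unfolding rec by (simp add: diff_divide_distrib)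
  also have "\<dots> = x * hermite (Suc k) x - sqrt (real k + 1) * hermite k x"
    by (simp add: hermite_eq_poly P_def real_sqrt_mult add_ac power2_eq_square del: real_sqrt_mult_self)
  finally show ?thesis .
qed

section \<open>The Gaussian functional on polynomials and orthonormality\<close>

lemma integrable_gauss_poly: "integrable lborel (\<lambda>x. std_normal_density x * poly p x)"
  unfolding poly_altdef sum_distrib_left
  using integrable_std_normal_moment
  by (intro Bochner_Integration.integrable_sum) (simp add: mult.left_commute)

text \<open>The expectation of \<open>p(Z)\<close> for a standard normal \<open>Z\<close>. As a
  linear functional on polynomials it makes the proof of orthogonality purely algebraic.\<close>

definition gauss_functional :: "real poly \<Rightarrow> real" where
  "gauss_functional p = (LINT x|lborel. std_normal_density x * poly p x)"

lemma gauss_functional_add: "gauss_functional (p + q) = gauss_functional p + gauss_functional q"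
  and gauss_functional_diff: "gauss_functional (p - q) = gauss_functional p - gauss_functional q"
  and gauss_functional_smult: "gauss_functional (smult c p) = c * gauss_functional p"
  unfolding gauss_functional_def
  by (simp_all add: distrib_left right_diff_distrib integrable_gauss_poly mult.left_commute)

lemma gauss_functional_monom_rec:
  "gauss_functional (monom 1 (Suc (Suc n))) = real (Suc n) * gauss_functional (monom 1 n)"
  "gauss_functional (monom 1 (Suc 0)) = 0"
proof -
  show "gauss_functional (monom 1 (Suc (Suc n))) = real (Suc n) * gauss_functional (monom 1 n)"
  proof (cases "even n")
    case True
    then obtain k where k: "n = 2 * k" by blast
    have "gauss_functional (monom 1 n) = fact (2 * k) / (2 ^ k * fact k)"
      unfolding gauss_functional_def k poly_monom mult_1_left by (rule integral_std_normal_moment_even)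
    moreover have "gauss_functional (monom 1 (Suc (Suc n))) = fact (2 * Suc k) / (2 ^ Suc k * fact (Suc k))"
      unfolding gauss_functional_def k poly_monom mult_1_left
      using integral_std_normal_moment_even[of "Suc k"] by simp
    moreover have "fact (2 * Suc k) / (2 ^ Suc k * fact (Suc k)) =
        (2 * (real k + 1)) * (real (Suc n) * fact (2 * k)) / ((2 * (real k + 1)) * (2 ^ k * fact k))"
      by (simp add: k algebra_simps)
    ultimately show ?thesis
      by (simp only: mult_divide_mult_cancel_left_if) simp
  next
    case False
    then obtain k where k: "n = 2 * k + 1" by (auto elim: oddE)
    have "gauss_functional (monom 1 n) = 0" "gauss_functional (monom 1 (Suc (Suc n))) = 0"
      unfolding gauss_functional_def k poly_monom mult_1_left
      using integral_std_normal_moment_odd[of k] integral_std_normal_moment_odd[of "Suc k"] by simp_all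
    then show ?thesis by simp
  qed
  show "gauss_functional (monom 1 (Suc 0)) = 0"
    unfolding gauss_functional_def poly_monom mult_1_left
    using integral_std_normal_moment_odd[of 0] by simp
qed

text \<open>Stein's identity. By linearity it reduces to monomials, where it is the moment recursion
  \<open>gauss_functional_monom_rec\<close>.\<close>

lemma gauss_functional_by_parts: "gauss_functional ([:0, 1:] * p) = gauss_functional (pderiv p)"
proof -
  have mon: "gauss_functional ([:0, 1:] * monom c n) = gauss_functional (pderiv (monom c n))" for c n
  proof (cases n)
    case 0
    have "monom c (Suc 0) = smult c (monom 1 (Suc 0))"
      by (simp add: smult_monom)
    then show ?thesis
      using gauss_functional_monom_rec(2)
      by (simp add: 0 pderiv_monom gauss_functional_smult flip: monom_Suc) (simp add: gauss_functional_def)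
  next
    case (Suc m)
    have "monom c (Suc (Suc m)) = smult c (monom 1 (Suc (Suc m)))"
         "monom (real (Suc m) * c) m = smult (real (Suc m) * c) (monom 1 m)"
      by (simp_all add: smult_monom)
    moreover have "[:0, 1:] * monom c (Suc m) = monom c (Suc (Suc m))"
      by (simp add: monom_Suc)
    ultimately show ?thesis
      using gauss_functional_monom_rec(1)[of m]
      by (simp only: Suc pderiv_monom gauss_functional_smult diff_Suc_1) simp
  qed
  have "gauss_functional ([:0, 1:] * (\<Sum>i\<in>S. monom (coeff p i) i)) =
      gauss_functional (pderiv (\<Sum>i\<in>S. monom (coeff p i) i))" if "finite S" for S
    using that
  proof induction
    case (insert i S)
    then show ?case
      using mon[of "coeff p i" i]
      by (simp only: sum.insert[OF insert.hyps] distrib_left gauss_functional_add pderiv_add)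
  qed (simp add: gauss_functional_def)
  from this[of "{..degree p}"] show ?thesis
    by (simp only: poly_as_sum_of_monoms finite_atMost)
qed

text \<open>The raising operator \<open>p \<mapsto> x p - p'\<close>, which produces the next
  Hermite polynomial, is adjoint to differentiation under the Gaussian functional, by Stein's
  identity and the product rule.\<close>

lemma gauss_functional_hermite_Suc:
  "gauss_functional (hermite_poly (Suc k) * q) = gauss_functional (hermite_poly k * pderiv q)"
proof -
  have "hermite_poly (Suc k) * q = [:0, 1:] * (hermite_poly k * q) - pderiv (hermite_poly k) * q"
    by (simp add: left_diff_distrib mult.assoc)
  then have "gauss_functional (hermite_poly (Suc k) * q) =
      gauss_functional (pderiv (hermite_poly k * q)) - gauss_functional (pderiv (hermite_poly k) * q)"
    by (simp only: gauss_functional_diff gauss_functional_by_parts)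
  then show ?thesis
    by (simp add: pderiv_mult gauss_functional_add mult.commute)
qed

lemma gauss_functional_1: "gauss_functional 1 = 1"
  unfolding gauss_functional_def using integral_std_normal_moment_even[of 0] by simp

text \<open>Adjointness and the Appell property lower both degrees by one and contribute a factor
  equal to the degree. Unequal degrees end with the derivative of a constant; equal ones accumulate
  the factorial.\<close>

lemma gauss_functional_hermite:
  "gauss_functional (hermite_poly k * hermite_poly l) = (if k = l then fact k else 0)"
proof (induction k arbitrary: l)
  case 0
  show ?case
  proof (cases l)
    case (Suc m)
    \<comment> \<open>The artificial factor 1 lets adjointness apply; its derivative
      vanishes.\<close>
    have "gauss_functional (hermite_poly l * 1) = 0"
      unfolding Suc gauss_functional_hermite_Suc by (simp add: gauss_functional_def)
    then show ?thesis by (simp add: Suc)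
  qed (simp add: gauss_functional_1)
next
  case (Suc k)
  show ?case
  proof (cases l)
    case 0
    then show ?thesis
      unfolding gauss_functional_hermite_Suc by (simp add: gauss_functional_def)
  next
    case l: (Suc m)
    show ?thesis
      unfolding l gauss_functional_hermite_Suc pderiv_hermite_poly_Suc
      by (simp add: gauss_functional_smult Suc)
  qed
qed

lemma hermite_orthonormal:
  "integrable lborel (\<lambda>x. std_normal_density x * (hermite k x * hermite l x))"
  "(LINT x|lborel. std_normal_density x * (hermite k x * hermite l x)) = (if k = l then 1 else 0)"
proof -
  have eq: "(\<lambda>x. std_normal_density x * (hermite k x * hermite l x)) =
     (\<lambda>x. std_normal_density x * poly (hermite_poly k * hermite_poly l) x / (sqrt (fact k) * sqrt (fact l)))"
    by (simp add: hermite_eq_poly)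
  show "integrable lborel (\<lambda>x. std_normal_density x * (hermite k x * hermite l x))"
    unfolding eq by (intro integrable_divide integrable_gauss_poly)
  have "(LINT x|lborel. std_normal_density x * (hermite k x * hermite l x)) =
      gauss_functional (hermite_poly k * hermite_poly l) / (sqrt (fact k) * sqrt (fact l))"
    unfolding eq gauss_functional_def by (rule integral_divide_zero)
  then show "(LINT x|lborel. std_normal_density x * (hermite k x * hermite l x)) = (if k = l then 1 else 0)"
    by (simp add: gauss_functional_hermite)
qed

lemma hermite_0 [simp]: "hermite 0 x = 1"
  by (simp add: hermite_eq_poly)

lemma borel_measurable_hermite [measurable]: "hermite k \<in> borel_measurable borel"
proof -
  have "hermite k = (\<lambda>x. poly (hermite_poly k) x / sqrt (fact k))"
    by (simp add: hermite_eq_poly fun_eq_iff)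
  then show ?thesis
    by (auto intro!: borel_measurable_continuous_onI continuous_intros)
qed

section \<open>Boundedness in the degree at a fixed point\<close>

text \<open>
  The energy \<open>F\<close> below grows by only \<open>(a\<^sup>2 + b\<^sup>2) / 2\<close> per step of the three-term recurrence, while for
  large \<open>k\<close> it exceeds \<open>k (a\<^sup>2 + b\<^sup>2) / 2\<close>. So \<open>F k / k\<close> is eventually decreasing.
\<close>

lemma hermite_bounded: "\<exists>C. \<forall>k. (hermite k x)\<^sup>2 \<le> C"
proof -
  define h where "h = (\<lambda>k. hermite k x)"
  define N where "N = (\<lambda>k. (h k)\<^sup>2 + (h (Suc k))\<^sup>2)"
  define F where "F = (\<lambda>k. (real k + 1) * (h (Suc k))\<^sup>2 - x * sqrt (real k + 1) * h k * h (Suc k)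
                        + (real k + 1/2) * (h k)\<^sup>2)"
  have F_step: "F (Suc k) = F k + N k / 2" for k
  proof -
    define a b c u v where "a = h k" and "b = h (Suc k)" and "c = h (k + 2)"
      and "u = sqrt (real k + 1)" and "v = sqrt (real k + 2)"
    have uv: "u\<^sup>2 = real k + 1" "v\<^sup>2 = real k + 2" by (simp_all add: u_def v_def)
    have rec: "v * c = x * b - u * a"
      using hermite_rec[of k x] by (simp add: a_def b_def c_def u_def v_def h_def)
    \<comment> \<open>By the recurrence, \<open>v * c\<close> and \<open>u * a\<close> add up to
      \<open>x * b\<close>, so the quadratic \<open>y * y - x * b * y\<close> takes the same value
      at both. The cross term of \<open>F (Suc k)\<close> is thereby traded for that of
      \<open>F k\<close>.\<close>
    have "(v * c)\<^sup>2 - x * b * (v * c) = (u * a)\<^sup>2 - x * b * (u * a)"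
      unfolding rec by algebra
    then have "v\<^sup>2 * c\<^sup>2 - x * v * b * c = u\<^sup>2 * a\<^sup>2 - x * u * a * b"
      by (simp add: power_mult_distrib mult_ac)
    then have "(real k + 2) * c\<^sup>2 - x * v * b * c = (real k + 1) * a\<^sup>2 - x * u * a * b"
      by (simp only: uv)
    then show ?thesis
      by (simp add: F_def N_def a_def b_def c_def u_def v_def algebra_simps add_divide_distrib)
  qed
  \<comment> \<open>From \<open>K0\<close> on, \<open>2 * \<bar>x\<bar>\<close> is at most
    \<open>sqrt k\<close>, and the geometric mean of \<open>k\<close> and \<open>k + 1\<close> is at
    most \<open>k + 1/2\<close>, so the cross term of \<open>F\<close> is absorbed by the squares.
    The extra 1 makes \<open>k - 1/2\<close> nonnegative.\<close>
  obtain K0 :: nat where "(2 * \<bar>x\<bar>)\<^sup>2 + 1 < K0" using reals_Archimedean2 by blast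
  moreover have "0 \<le> (2 * \<bar>x\<bar>)\<^sup>2" by (rule zero_le_power2)
  ultimately have K: "(2 * \<bar>x\<bar>)\<^sup>2 \<le> K0" "1 \<le> K0" by linarith+
  have low: "(real k + 1) * N k \<le> 2 * F k" if k: "k \<ge> K0" for k
  proof -
    define a b u where "a = h k" and "b = h (Suc k)" and "u = sqrt (real k + 1)"
    have "(2 * \<bar>x\<bar>)\<^sup>2 \<le> real k"
      using K(1) k by linarith
    then have xk: "2 * \<bar>x\<bar> \<le> sqrt (real k)" by (rule real_le_rsqrt)
    have "2 * \<bar>x\<bar> * u \<le> sqrt (real k) * u"
      using xk by (intro mult_right_mono) (simp_all add: u_def)
    also have "\<dots> \<le> real k + 1 / 2"
    proof -
      have "0 \<le> (u - sqrt (real k))\<^sup>2" by simp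
      then show ?thesis by (simp add: power2_diff u_def algebra_simps)
    qed
    finally have xu: "2 * \<bar>x * u\<bar> \<le> real k + 1/2" by (simp add: abs_mult u_def)
    have ab: "2 * \<bar>a * b\<bar> \<le> a\<^sup>2 + b\<^sup>2"
      using zero_le_power2[of "\<bar>a\<bar> - \<bar>b\<bar>"] by (simp add: power2_diff abs_mult)
    have "2 * \<bar>x * u\<bar> * (2 * \<bar>a * b\<bar>) \<le> (real k + 1/2) * (a\<^sup>2 + b\<^sup>2)"
      using xu ab by (intro mult_mono) auto
    moreover have "x * u * (a * b) \<le> \<bar>x * u\<bar> * \<bar>a * b\<bar>"
      by (metis abs_ge_self abs_mult)
    ultimately have *: "4 * (x * u * (a * b)) \<le> (real k + 1/2) * (a\<^sup>2 + b\<^sup>2)"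
      by linarith
    have "0 \<le> a\<^sup>2 * (real k - 1/2)"
      using K(2) k by (intro mult_nonneg_nonneg) auto
    moreover have "0 \<le> b\<^sup>2 * (real k + 3/2)" by simp
    moreover have "2 * real k * a\<^sup>2 + (2 * real k + 2) * b\<^sup>2 - (real k + 1/2) * (a\<^sup>2 + b\<^sup>2) =
        a\<^sup>2 * (real k - 1/2) + b\<^sup>2 * (real k + 3/2)"
      by algebra
    ultimately have "4 * (x * u * (a * b)) \<le> 2 * real k * a\<^sup>2 + (2 * real k + 2) * b\<^sup>2"
      using * by linarith
    then show ?thesis
      by (simp add: F_def N_def a_def b_def u_def algebra_simps)
  qed
  have N_nonneg: "0 \<le> N k" for k by (simp add: N_def)
  \<comment> \<open>Energy growth and the lower bound give
    \<open>F (k + 1) \<le> F k * (k + 2) / (k + 1)\<close>, so \<open>F k / (k + 1)\<close> does not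
    increase from \<open>K0\<close> on.\<close>
  have dec: "F (K0 + m) \<le> F K0 / (real K0 + 1) * (real (K0 + m) + 1)" for m
  proof (induction m)
    case (Suc m)
    have "N (K0 + m) / 2 \<le> F (K0 + m) / (real (K0 + m) + 1)"
      using low[of "K0 + m"] by (subst pos_le_divide_eq) (auto simp: mult_ac)
    then have "F (K0 + Suc m) \<le> F (K0 + m) + F (K0 + m) / (real (K0 + m) + 1)"
      using F_step[of "K0 + m"] by simp
    also have "\<dots> = F (K0 + m) / (real (K0 + m) + 1) * (real (K0 + Suc m) + 1)"
      by (simp add: field_simps)
    also have "\<dots> \<le> F K0 / (real K0 + 1) * (real (K0 + Suc m) + 1)"
      using Suc by (intro mult_right_mono) (simp_all add: pos_divide_le_eq)
    finally show ?case .
  qed simp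
  define C where "C = Max (insert (2 * (F K0 / (real K0 + 1))) ((\<lambda>k. (h k)\<^sup>2) ` {..<K0}))"
  have "(h k)\<^sup>2 \<le> C" for k
  proof (cases "k < K0")
    case True
    then show ?thesis unfolding C_def by (intro Max_ge) auto
  next
    case False
    define D where "D = F K0 / (real K0 + 1)"
    have "(real k + 1) * N k \<le> 2 * (D * (real k + 1))"
      using low[of k] dec[of "k - K0"] False by (simp add: D_def)
    then have "(real k + 1) * N k \<le> (real k + 1) * (2 * D)"
      by (simp add: mult_ac)
    then have "N k \<le> 2 * D" by (subst (asm) mult_le_cancel_left_pos) auto
    moreover have "2 * D \<le> C" unfolding C_def D_def by (intro Max_ge) auto
    moreover have "(h k)\<^sup>2 \<le> N k" by (simp add: N_def)
    ultimately show ?thesis by simp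
  qed
  then show ?thesis unfolding h_def by blast
qed

section \<open>Uniqueness of reproducing kernel Hilbert spaces\<close>

text \<open>The core of Cauchy-Schwarz, with degenerate leading coefficients included. With
  \<open>a = 0\<close> it forces \<open>b = 0\<close>, which is its use in the uniqueness
  proof.\<close>

lemma nonneg_quadratic_discriminant:
  fixes a b c :: real
  assumes "\<And>t. 0 \<le> a + 2 * t * b + t\<^sup>2 * c"
  shows "b\<^sup>2 \<le> a * c"
proof (cases "c > 0")
  case True
  have "0 \<le> a + 2 * (- b / c) * b + (- b / c)\<^sup>2 * c" by (rule assms)
  also have "\<dots> = a - b\<^sup>2 / c"
    using True by (simp add: power2_eq_square)
  finally show ?thesis using True by (simp add: field_simps)
next
  case False
  have "b = 0"
  proof (rule ccontr)
    assume "b \<noteq> 0"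
    \<comment> \<open>Chosen so that the affine part \<open>a + 2 * t * b\<close> equals
      \<open>-1\<close>.\<close>
    define t where "t = - (a + 1) / (2 * b)"
    have "0 \<le> a + 2 * t * b + t\<^sup>2 * c" by (rule assms)
    also have "\<dots> \<le> a + 2 * t * b" using False by (simp add: mult_nonneg_nonpos)
    also have "\<dots> = - 1" using \<open>b \<noteq> 0\<close> by (simp add: t_def) (simp add: field_simps)
    finally show False by simp
  qed
  have "0 \<le> a * c"
  proof (cases "c = 0")
    case False
    with \<open>\<not> c > 0\<close> have "c < 0" by simp
    \<comment> \<open>Large enough that \<open>t * (- c)\<close> already exceeds \<open>a\<close>;
      the summand 1 ensures \<open>t \<ge> 1\<close>, hence that squaring \<open>t\<close> only
      helps.\<close>
    define t where "t = (\<bar>a\<bar> + 1) / (- c) + 1"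
    have t: "t \<ge> 1" using \<open>c < 0\<close> by (simp add: t_def divide_nonneg_neg)
    then have "t * (- c) \<le> t\<^sup>2 * (- c)"
      using \<open>c < 0\<close> by (intro mult_right_mono) (simp_all add: power2_eq_square)
    moreover have "t * (- c) = \<bar>a\<bar> + 1 - c" using \<open>c < 0\<close> by (simp add: t_def field_simps)
    ultimately have "a + 2 * t * b + t\<^sup>2 * c < 0" unfolding \<open>b = 0\<close> using \<open>c < 0\<close> by linarith
    with assms[of t] show ?thesis by simp
  qed simp
  with \<open>b = 0\<close> show ?thesis by simp
qed

context rkhs
begin

lemma comb_closed:
  assumes "f \<in> H" "g \<in> H"
  shows "(\<lambda>x\<in>X. f x + t * g x) \<in> H"
  using add_closed[OF assms(1) scale_closed[OF assms(2), of t]] by (simp cong: restrict_cong)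

lemma ip_comb:
  assumes "f \<in> H" "g \<in> H" "h \<in> H"
  shows "ip (\<lambda>x\<in>X. f x + t * g x) h = ip f h + t * ip g h"
  using ip_add[OF assms(1) scale_closed[OF assms(2), of t] assms(3)] ip_scale[OF assms(2,3), of t]
  by (simp cong: restrict_cong)

lemma ip_comb_self:
  assumes "f \<in> H" "g \<in> H"
  shows "ip (\<lambda>x\<in>X. f x + t * g x) (\<lambda>x\<in>X. f x + t * g x) = ip f f + 2 * t * ip f g + t\<^sup>2 * ip g g"
proof -
  define u where "u = (\<lambda>x\<in>X. f x + t * g x)"
  have u: "u \<in> H" unfolding u_def by (rule comb_closed[OF assms])
  have u_ip: "ip u h = ip f h + t * ip g h" if "h \<in> H" for h
    unfolding u_def by (rule ip_comb[OF assms that])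
  have "ip u u = ip u f + t * ip u g"
    using u_ip[OF u] ip_commute[OF assms(1) u] ip_commute[OF assms(2) u] by simp
  also have "\<dots> = ip f f + 2 * t * ip f g + t\<^sup>2 * ip g g"
    using u_ip[OF assms(1)] u_ip[OF assms(2)] ip_commute[OF assms]
    by (simp add: power2_eq_square algebra_simps)
  finally show ?thesis unfolding u_def .
qed

lemma diff_closed:
  assumes "f \<in> H" "g \<in> H"
  shows "(\<lambda>x\<in>X. f x - g x) \<in> H"
  using comb_closed[OF assms, of "-1"] by simp

lemma ip_diff_self:
  assumes "f \<in> H" "g \<in> H"
  shows "ip (\<lambda>x\<in>X. f x - g x) (\<lambda>x\<in>X. f x - g x) = ip f f - 2 * ip f g + ip g g"
  using ip_comb_self[OF assms, of "-1"] by simp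

lemma ip_kernel_self:
  assumes "y \<in> X"
  shows "ip (\<lambda>x\<in>X. K x y) (\<lambda>x\<in>X. K x y) = K y y"
  using reproducing[OF kernel_closed[OF assms] assms] assms by simp

text \<open>Cauchy-Schwarz against the kernel function at \<open>y\<close>, which represents
  evaluation at \<open>y\<close> and has squared norm \<open>K y y\<close>.\<close>

lemma eval_bound:
  assumes "f \<in> H" "y \<in> X"
  shows "(f y)\<^sup>2 \<le> ip f f * K y y"
proof (rule nonneg_quadratic_discriminant)
  fix t
  have "0 \<le> ip (\<lambda>x\<in>X. f x + t * (\<lambda>x\<in>X. K x y) x) (\<lambda>x\<in>X. f x + t * (\<lambda>x\<in>X. K x y) x)"
    by (intro ip_nonneg comb_closed assms kernel_closed)
  then show "0 \<le> ip f f + 2 * t * f y + t\<^sup>2 * K y y"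
    unfolding ip_comb_self[OF assms(1) kernel_closed[OF assms(2)]]
    by (simp only: reproducing[OF assms, symmetric] ip_kernel_self[OF assms(2)])
qed

text \<open>Evaluations are bounded functionals, so a norm limit is determined by its pointwise
  values. This identifies limits that are taken in different spaces.\<close>

lemma eval_tendsto:
  assumes "\<And>n. F n \<in> H" "f \<in> H" "y \<in> X"
    and "(\<lambda>n. sqrt (ip (\<lambda>x\<in>X. F n x - f x) (\<lambda>x\<in>X. F n x - f x))) \<longlonglongrightarrow> 0"
  shows "(\<lambda>n. F n y) \<longlonglongrightarrow> f y"
proof -
  define u where "u = (\<lambda>n. \<lambda>x\<in>X. F n x - f x)"
  have bound: "norm (F n y - f y) \<le> sqrt (ip (u n) (u n)) * sqrt (K y y)" for n
  proof -
    have "u n \<in> H" unfolding u_def by (rule diff_closed[OF assms(1,2)])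
    from real_sqrt_le_mono[OF eval_bound[OF this assms(3)]]
    have "\<bar>u n y\<bar> \<le> sqrt (ip (u n) (u n)) * sqrt (K y y)" by (simp add: real_sqrt_mult)
    moreover have "u n y = F n y - f y" using assms(3) by (simp add: u_def)
    ultimately show ?thesis by simp
  qed
  have null: "(\<lambda>n. sqrt (ip (u n) (u n)) * sqrt (K y y)) \<longlonglongrightarrow> 0"
    unfolding u_def by (rule tendsto_mult_left_zero[OF assms(4)])
  have "(\<lambda>n. F n y - f y) \<longlonglongrightarrow> 0"
    by (rule Lim_null_comparison[OF always_eventually[OF allI[OF bound]] null])
  then show ?thesis by (simp add: LIM_zero_iff)
qed

end

text \<open>Only completeness needs an argument: a Cauchy sequence in the intersection has a limit
  in each space, and both limits agree pointwise by \<open>eval_tendsto\<close>.\<close>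

lemma rkhs_Int:
  assumes "rkhs X G ip K" "rkhs X H ip K"
  shows "rkhs X (G \<inter> H) ip K"
proof -
  interpret G: rkhs X G ip K by (rule assms(1))
  interpret H: rkhs X H ip K by (rule assms(2))
  show ?thesis
  proof (rule rkhs.intro)
    fix F
    assume F: "F n \<in> G \<inter> H" for n :: nat
    assume Cauchy: "\<exists>N. \<forall>m\<ge>N. \<forall>n\<ge>N. sqrt (ip (\<lambda>x\<in>X. F m x - F n x) (\<lambda>x\<in>X. F m x - F n x)) < e"
      if "0 < e" for e
    have FG: "F n \<in> G" and FH: "F n \<in> H" for n using F[of n] by simp_all
    from G.complete[OF FG Cauchy] obtain g where g: "g \<in> G" "(\<lambda>n. sqrt (ip (\<lambda>x\<in>X. F n x - g x) (\<lambda>x\<in>X. F n x - g x))) \<longlonglongrightarrow> 0"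
      by blast
    from H.complete[OF FH Cauchy] obtain h where h: "h \<in> H" "(\<lambda>n. sqrt (ip (\<lambda>x\<in>X. F n x - h x) (\<lambda>x\<in>X. F n x - h x))) \<longlonglongrightarrow> 0"
      by blast
    have "g y = h y" if "y \<in> X" for y
      using LIMSEQ_unique[OF G.eval_tendsto[OF FG g(1) that g(2)] H.eval_tendsto[OF FH h(1) that h(2)]] .
    then have "g = h"
      by (rule extensionalityI[OF subsetD[OF G.extensional g(1)] subsetD[OF H.extensional h(1)]])
    then have "g \<in> G \<inter> H" using g(1) h(1) by simp
    with g(2) show "\<exists>f\<in>G \<inter> H. (\<lambda>n. sqrt (ip (\<lambda>x\<in>X. F n x - f x) (\<lambda>x\<in>X. F n x - f x))) \<longlonglongrightarrow> 0"
      by (rule bexI)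
  next
    show "G \<inter> H \<subseteq> extensional X" using G.extensional by blast
    show "(\<lambda>x\<in>X. 0) \<in> G \<inter> H" using G.zero_closed H.zero_closed by blast
    show "f \<in> G \<inter> H \<Longrightarrow> g \<in> G \<inter> H \<Longrightarrow> (\<lambda>x\<in>X. f x + g x) \<in> G \<inter> H" for f g
      by (intro IntI G.add_closed H.add_closed) simp_all
    show "f \<in> G \<inter> H \<Longrightarrow> (\<lambda>x\<in>X. c * f x) \<in> G \<inter> H" for c f
      by (intro IntI G.scale_closed H.scale_closed) simp_all
    show "f \<in> G \<inter> H \<Longrightarrow> g \<in> G \<inter> H \<Longrightarrow> ip f g = ip g f" for f g
      by (rule G.ip_commute; erule IntD1)
    show "f \<in> G \<inter> H \<Longrightarrow> g \<in> G \<inter> H \<Longrightarrow> h \<in> G \<inter> H \<Longrightarrow>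
        ip (\<lambda>x\<in>X. f x + g x) h = ip f h + ip g h" for f g h
      by (rule G.ip_add; erule IntD1)
    show "f \<in> G \<inter> H \<Longrightarrow> g \<in> G \<inter> H \<Longrightarrow> ip (\<lambda>x\<in>X. c * f x) g = c * ip f g" for c f g
      by (rule G.ip_scale; erule IntD1)
    show "f \<in> G \<inter> H \<Longrightarrow> 0 \<le> ip f f" for f
      by (rule G.ip_nonneg; erule IntD1)
    show "f \<in> G \<inter> H \<Longrightarrow> ip f f = 0 \<Longrightarrow> f = (\<lambda>x\<in>X. 0)" for f
      by (rule G.ip_definite) simp_all
    show "y \<in> X \<Longrightarrow> (\<lambda>x\<in>X. K x y) \<in> G \<inter> H" for y
      by (intro IntI G.kernel_closed H.kernel_closed) simp_all
    show "f \<in> G \<inter> H \<Longrightarrow> y \<in> X \<Longrightarrow> f y = ip f (\<lambda>x\<in>X. K x y)" for f y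
      by (rule G.reproducing) simp_all
  qed
qed

text \<open>
  For \<open>f \<in> H\<close> a minimizing sequence \<open>g n \<in> G\<close> for the distance from \<open>f\<close> is Cauchy by the
  parallelogram law. The residual of its limit is orthogonal to all kernel functions, so it vanishes.
\<close>

lemma rkhs_subset_imp_eq:
  assumes "rkhs X G ip K" "rkhs X H ip K" "G \<subseteq> H"
  shows "G = H"
proof
  interpret G: rkhs X G ip K by (rule assms(1))
  interpret H: rkhs X H ip K by (rule assms(2))
  show "H \<subseteq> G"
  proof
    fix f assume f: "f \<in> H"
    define q where "q = (\<lambda>u. ip u u)"
    define D where "D = (\<lambda>g. q (\<lambda>x\<in>X. f x - g x))"
    define d where "d = (INF g\<in>G. D g)"
    have D_nonneg: "0 \<le> D g" if "g \<in> G" for g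
      unfolding D_def q_def by (rule H.ip_nonneg[OF H.diff_closed[OF f subsetD[OF assms(3) that]]])
    have bdd: "bdd_below (D ` G)" by (rule bdd_belowI[of _ 0]) (use D_nonneg in blast)
    have d_le: "d \<le> D g" if "g \<in> G" for g
      unfolding d_def by (rule cINF_lower[OF bdd that])
    have "\<exists>g\<in>G. D g < d + 1 / (real n + 1)" for n :: nat
    proof -
      have ne: "G \<noteq> {}" using G.zero_closed by blast
      have "(INF g\<in>G. D g) < d + 1 / (real n + 1)"
        unfolding d_def by (simp add: add_pos_nonneg)
      then show ?thesis by (rule cINF_less_iff[OF ne bdd, THEN iffD1])
    qed
    then have "\<forall>n::nat. \<exists>g. g \<in> G \<and> D g < d + 1 / (real n + 1)" by blast
    from choice[OF this] obtain g where g: "g n \<in> G" "D (g n) < d + 1 / (real n + 1)" for n :: nat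
      by blast
    \<comment> \<open>The parallelogram law for \<open>f - u\<close> and \<open>f - v\<close>,
      expanded through the inner product; half their sum is \<open>f\<close> minus the midpoint of
      \<open>u\<close> and \<open>v\<close>.\<close>
    have par: "q (\<lambda>x\<in>X. u x - v x) = 2 * D u + 2 * D v - 4 * D (\<lambda>x\<in>X. 1/2 * (u x + v x))"
      if "u \<in> G" "v \<in> G" for u v
    proof -
      define w where "w = (\<lambda>x\<in>X. u x + 1 * v x)"
      define h where "h = (\<lambda>x\<in>X. 1/2 * w x)"
      have uv: "u \<in> H" "v \<in> H" using that assms(3) by auto
      have w: "w \<in> H" unfolding w_def by (rule H.comb_closed[OF uv])
      have h: "h \<in> H" unfolding h_def by (rule H.scale_closed[OF w])
      have w_ip: "ip w z = ip u z + 1 * ip v z" if "z \<in> H" for z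
        unfolding w_def by (rule H.ip_comb[OF uv that])
      have h_ip: "ip h z = 1/2 * ip w z" if "z \<in> H" for z
        unfolding h_def by (rule H.ip_scale[OF w that])
      have wf: "ip f w = ip f u + ip f v"
        using w_ip[OF f] H.ip_commute[OF f w] H.ip_commute[OF f uv(1)] H.ip_commute[OF f uv(2)] by linarith
      have hf: "ip f h = 1/2 * ip f w"
        using h_ip[OF f] H.ip_commute[OF f h] H.ip_commute[OF f w] by linarith
      have hh: "ip h h = 1/4 * ip w w"
        using h_ip[OF h] h_ip[OF w] H.ip_commute[OF w h] by linarith
      have ww: "ip w w = ip u u + 2 * ip u v + ip v v"
        using w_ip[OF w] w_ip[OF uv(1)] w_ip[OF uv(2)] H.ip_commute[OF uv]
          H.ip_commute[OF uv(1) w] H.ip_commute[OF uv(2) w] by linarith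
      have D: "D z = ip f f - 2 * ip f z + ip z z" if "z \<in> H" for z
        unfolding D_def q_def by (rule H.ip_diff_self[OF f that])
      have heq: "(\<lambda>x\<in>X. 1/2 * (u x + v x)) = h"
        unfolding h_def w_def by (rule restrict_ext) simp
      have "q (\<lambda>x\<in>X. u x - v x) = ip u u - 2 * ip u v + ip v v"
        unfolding q_def by (rule H.ip_diff_self[OF uv])
      then show ?thesis
        unfolding heq D[OF h] D[OF uv(1)] D[OF uv(2)] hf hh wf ww by (simp add: field_simps)
    qed
    \<comment> \<open>The midpoint of \<open>g m\<close> and \<open>g n\<close> lies in
      \<open>G\<close>, so its distance value is at least \<open>d\<close>, and the terms
      \<open>2 * d + 2 * d - 4 * d\<close> cancel.\<close>
    have close: "q (\<lambda>x\<in>X. g m x - g n x) \<le> 2 / (real m + 1) + 2 / (real n + 1)" for m n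
    proof -
      have "(\<lambda>x\<in>X. 1/2 * (g m x + g n x)) \<in> G"
      proof -
        have "(\<lambda>x\<in>X. 1/2 * (\<lambda>x\<in>X. g m x + g n x) x) \<in> G"
          by (intro G.scale_closed G.add_closed g(1))
        also have "(\<lambda>x\<in>X. 1/2 * (\<lambda>x\<in>X. g m x + g n x) x) = (\<lambda>x\<in>X. 1/2 * (g m x + g n x))"
          by (rule restrict_ext) simp
        finally show ?thesis .
      qed
      from d_le[OF this] show ?thesis
        unfolding par[OF g(1) g(1), of m n] using g(2)[of m] g(2)[of n] by linarith
    qed
    have "\<exists>N. \<forall>m\<ge>N. \<forall>n\<ge>N. sqrt (ip (\<lambda>x\<in>X. g m x - g n x) (\<lambda>x\<in>X. g m x - g n x)) < e" if "0 < e" for e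
    proof -
      obtain N :: nat where N: "4 / e\<^sup>2 < N" using reals_Archimedean2 by blast
      have "sqrt (q (\<lambda>x\<in>X. g m x - g n x)) < e" if "m \<ge> N" "n \<ge> N" for m n
      proof -
        have "2 / (real m + 1) + 2 / (real n + 1) \<le> 2 / (real N + 1) + 2 / (real N + 1)"
          using that by (intro add_mono divide_left_mono) auto
        also have "\<dots> = 4 / (real N + 1)" by simp
        also have "\<dots> < e\<^sup>2"
        proof (subst pos_divide_less_eq)
          have "4 < e\<^sup>2 * real N"
            using N \<open>0 < e\<close> by (subst (asm) pos_divide_less_eq) (auto simp: mult_ac)
          also have "\<dots> \<le> e\<^sup>2 * (real N + 1)" by (intro mult_left_mono) auto
          finally show "4 < e\<^sup>2 * (real N + 1)" .
        qed simp
        finally have "q (\<lambda>x\<in>X. g m x - g n x) < e\<^sup>2" using close[of m n] by linarith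
        from real_sqrt_less_mono[OF this] show ?thesis using \<open>0 < e\<close> by simp
      qed
      then show ?thesis unfolding q_def by blast
    qed
    from G.complete[OF g(1) this] obtain h where h: "h \<in> G"
      "(\<lambda>n. sqrt (ip (\<lambda>x\<in>X. g n x - h x) (\<lambda>x\<in>X. g n x - h x))) \<longlonglongrightarrow> 0" by blast
    have "f y = h y" if y: "y \<in> X" for y
    proof -
      let ?k = "\<lambda>x\<in>X. K x y"
      have k: "?k \<in> G" by (rule G.kernel_closed[OF y])
      \<comment> \<open>Perturbing \<open>g n\<close> by \<open>t\<close> times the kernel function
        stays in \<open>G\<close> and cannot bring the squared distance below \<open>d\<close>. By
        the reproducing property the linear term is \<open>f y - g n y\<close>.\<close>
      have step: "2 * t * (f y - g n y) \<le> 1 / (real n + 1) + t\<^sup>2 * K y y" for t n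
      proof -
        let ?u = "\<lambda>x\<in>X. f x - g n x"
        have u: "?u \<in> H" using f g(1) assms(3) by (auto intro: H.diff_closed)
        have kH: "?k \<in> H" using k assms(3) by blast
        have eq: "(\<lambda>x\<in>X. f x - (\<lambda>x\<in>X. g n x + t * ?k x) x) = (\<lambda>x\<in>X. ?u x + (- t) * ?k x)"
          by (rule restrict_ext) simp
        have "(\<lambda>x\<in>X. g n x + t * ?k x) \<in> G" by (rule G.comb_closed[OF g(1) k])
        then have "d \<le> D (\<lambda>x\<in>X. g n x + t * ?k x)" by (rule d_le)
        also have "\<dots> = q ?u + 2 * (- t) * ip ?u ?k + (- t)\<^sup>2 * ip ?k ?k"
          unfolding D_def q_def eq by (rule H.ip_comb_self[OF u kH])
        finally have "d \<le> q ?u + 2 * (- t) * ip ?u ?k + t\<^sup>2 * ip ?k ?k"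
          by (simp only: power2_minus)
        moreover have "ip ?u ?k = f y - g n y"
          unfolding H.reproducing[OF u y, symmetric] using y by simp
        moreover have "ip ?k ?k = K y y" by (rule G.ip_kernel_self[OF y])
        moreover have "q ?u < d + 1 / (real n + 1)" using g(2)[of n] by (simp only: D_def)
        ultimately show ?thesis by simp
      qed
      have lim: "(\<lambda>n. g n y) \<longlonglongrightarrow> h y" by (rule G.eval_tendsto[OF g(1) h(1) y h(2)])
      have null: "(\<lambda>n. 1 / (real n + 1)) \<longlonglongrightarrow> 0"
        using LIMSEQ_inverse_real_of_nat by (simp add: inverse_eq_divide add.commute)
      have limit: "2 * t * (f y - h y) \<le> 0 + t\<^sup>2 * K y y" for t
      proof (intro LIMSEQ_le)
        show "(\<lambda>n. 2 * t * (f y - g n y)) \<longlonglongrightarrow> 2 * t * (f y - h y)"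
          by (intro tendsto_intros lim)
        show "(\<lambda>n. 1 / (real n + 1) + t\<^sup>2 * K y y) \<longlonglongrightarrow> 0 + t\<^sup>2 * K y y"
          by (intro tendsto_intros null)
      qed (use step in blast)
      \<comment> \<open>With \<open>t\<close> replaced by \<open>- t\<close>, this is a nonnegative
        quadratic without constant term, so its linear coefficient \<open>f y - h y\<close>
        vanishes.\<close>
      then have "0 \<le> 0 + 2 * t * (f y - h y) + t\<^sup>2 * K y y" for t
        using limit[of "-t"] by simp
      from nonneg_quadratic_discriminant[OF this] show ?thesis by simp
    qed
    then have "f = h"
      using f h(1) G.extensional H.extensional by (intro extensionalityI[of f X h]) auto
    with h show "f \<in> G" by simp
  qed
qed (fact assms(3))

lemma rkhs_unique:
  assumes "rkhs X G ip K" "rkhs X H ip K"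
  shows "G = H"
  using rkhs_subset_imp_eq[OF rkhs_Int[OF assms] assms(1)] rkhs_subset_imp_eq[OF rkhs_Int[OF assms] assms(2)]
  by auto

section \<open>Weighted series spaces\<close>

text \<open>Isolates the Hilbert space of coefficient sequences. That coefficients can be recovered
  from the function enters as the hypothesis of \<open>rkhs_series\<close>, where orthonormality is
  supplied later.\<close>

locale weighted_series =
  fixes X :: "'a set" and I :: "'i set" and e :: "'i \<Rightarrow> 'a \<Rightarrow> real" and r :: "'i \<Rightarrow> real"
  assumes r_pos: "\<And>k. k \<in> I \<Longrightarrow> 0 < r k"
    and kernel_summable: "\<And>x. x \<in> X \<Longrightarrow> (\<lambda>k. r k * (e k x)\<^sup>2) summable_on I"
begin

definition W :: "('i \<Rightarrow> real) set" where
  "W = {a. (\<lambda>k. (a k)\<^sup>2 / r k) summable_on I}"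

definition series :: "('i \<Rightarrow> real) \<Rightarrow> 'a \<Rightarrow> real" where
  "series a = (\<lambda>x\<in>X. \<Sum>\<^sub>\<infinity>k\<in>I. a k * e k x)"

lemma W_D: "a \<in> W \<Longrightarrow> (\<lambda>k. (a k)\<^sup>2 / r k) summable_on I"
  by (simp add: W_def)

text \<open>Comparison with the sum of the two squares, by the arithmetic-geometric mean
  inequality.\<close>

lemma W_prod_summable:
  assumes "a \<in> W" "b \<in> W"
  shows "(\<lambda>k. 1 / r k * a k * b k) summable_on I"
proof -
  have "(\<lambda>k. norm ((a k)\<^sup>2 / r k + (b k)\<^sup>2 / r k)) summable_on I"
    using summable_on_add[OF W_D[OF assms(1)] W_D[OF assms(2)]]
    by (rule summable_on_iff_abs_summable_on_real[THEN iffD1])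
  then have "(\<lambda>k. norm (1 / r k * a k * b k)) summable_on I"
  proof (rule Infinite_Sum.abs_summable_on_comparison_test)
    fix k assume "k \<in> I"
    then have r: "0 < r k" by (rule r_pos)
    have "2 * \<bar>a k * b k\<bar> \<le> (a k)\<^sup>2 + (b k)\<^sup>2"
      using zero_le_power2[of "\<bar>a k\<bar> - \<bar>b k\<bar>"] by (simp add: power2_diff abs_mult)
    then have "\<bar>a k * b k\<bar> \<le> (a k)\<^sup>2 + (b k)\<^sup>2"
      using abs_ge_zero[of "a k * b k"] by linarith
    then have "\<bar>a k * b k\<bar> / r k \<le> ((a k)\<^sup>2 + (b k)\<^sup>2) / r k"
      using r by (simp add: divide_right_mono)
    then show "norm (1 / r k * a k * b k) \<le> norm ((a k)\<^sup>2 / r k + (b k)\<^sup>2 / r k)"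
      using r by (simp add: abs_mult add_divide_distrib)
  qed
  then show ?thesis by (rule abs_summable_summable)
qed

lemma W_comb:
  assumes "a \<in> W" "b \<in> W"
  shows "(\<lambda>k. a k + t * b k) \<in> W"
proof -
  have "(\<lambda>k. (a k)\<^sup>2 / r k + (2 * t * (1 / r k * a k * b k) + t\<^sup>2 * ((b k)\<^sup>2 / r k))) summable_on I"
    by (intro summable_on_add summable_on_cmult_right W_prod_summable W_D assms)
  moreover have "(\<lambda>k. (a k)\<^sup>2 / r k + (2 * t * (1 / r k * a k * b k) + t\<^sup>2 * ((b k)\<^sup>2 / r k))) =
      (\<lambda>k. (a k + t * b k)\<^sup>2 / r k)"
    by (rule ext) (simp add: power2_eq_square add_divide_distrib algebra_simps)
  ultimately show ?thesis by (simp only: W_def mem_Collect_eq)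
qed

lemma W_0: "(\<lambda>_. 0) \<in> W" by (simp add: W_def)

lemma W_add: "a \<in> W \<Longrightarrow> b \<in> W \<Longrightarrow> (\<lambda>k. a k + b k) \<in> W"
  using W_comb[of a b 1] by simp

lemma W_scale: "b \<in> W \<Longrightarrow> (\<lambda>k. t * b k) \<in> W"
  using W_comb[OF W_0, of b t] by simp

lemma W_diff: "a \<in> W \<Longrightarrow> b \<in> W \<Longrightarrow> (\<lambda>k. a k - b k) \<in> W"
  using W_comb[of a b "-1"] by simp

lemma W_kernel:
  assumes "x \<in> X"
  shows "(\<lambda>k. r k * e k x) \<in> W"
proof -
  have "(\<lambda>k. (r k * e k x)\<^sup>2 / r k) summable_on I \<longleftrightarrow> (\<lambda>k. r k * (e k x)\<^sup>2) summable_on I"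
    by (rule summable_on_cong) (simp add: power2_eq_square)
  with kernel_summable[OF assms] show ?thesis by (simp add: W_def)
qed

text \<open>The term \<open>a k * e k x\<close> is the weighted product of \<open>a\<close> with the
  coefficient \<open>r k * e k x\<close> of the kernel function at \<open>x\<close>.\<close>

lemma series_summable:
  assumes "a \<in> W" "x \<in> X"
  shows "(\<lambda>k. a k * e k x) summable_on I"
proof -
  have "(\<lambda>k. 1 / r k * a k * (r k * e k x)) summable_on I \<longleftrightarrow> (\<lambda>k. a k * e k x) summable_on I"
    by (rule summable_on_cong) (use r_pos in force)
  with W_prod_summable[OF assms(1) W_kernel[OF assms(2)]] show ?thesis by simp
qed

lemma series_add:
  assumes "a \<in> W" "b \<in> W"
  shows "(\<lambda>x\<in>X. series a x + series b x) = series (\<lambda>k. a k + b k)"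
  unfolding series_def
  by (rule restrict_ext) (simp add: distrib_right infsum_add series_summable assms)

lemma series_diff:
  assumes "a \<in> W" "b \<in> W"
  shows "(\<lambda>x\<in>X. series a x - series b x) = series (\<lambda>k. a k - b k)"
proof -
  have "(\<Sum>\<^sub>\<infinity>k\<in>I. (a k - b k) * e k x) = (\<Sum>\<^sub>\<infinity>k\<in>I. a k * e k x) - (\<Sum>\<^sub>\<infinity>k\<in>I. b k * e k x)" if "x \<in> X" for x
    using infsum_add[OF series_summable[OF assms(1) that]
        summable_on_uminus[THEN iffD2, OF series_summable[OF assms(2) that]]]
    by (simp add: infsum_uminus left_diff_distrib)
  then show ?thesis
    unfolding series_def by (intro restrict_ext) simp
qed

lemma series_scale: "(\<lambda>x\<in>X. c * series a x) = series (\<lambda>k. c * a k)"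
  unfolding series_def
  by (rule restrict_ext) (simp add: mult.assoc infsum_cmult_right')

definition wip :: "('i \<Rightarrow> real) \<Rightarrow> ('i \<Rightarrow> real) \<Rightarrow> real" where
  "wip a b = (\<Sum>\<^sub>\<infinity>k\<in>I. 1 / r k * a k * b k)"

lemma wip_self: "wip a a = (\<Sum>\<^sub>\<infinity>k\<in>I. (a k)\<^sup>2 / r k)"
  unfolding wip_def by (rule infsum_cong) (simp add: power2_eq_square)

lemma wip_nonneg: "0 \<le> wip a a"
  unfolding wip_self using r_pos by (intro infsum_nonneg) (simp add: less_imp_le)

lemma wip_coord:
  assumes "a \<in> W" "k \<in> I"
  shows "(a k)\<^sup>2 / r k \<le> wip a a"
  using finite_sum_le_infsum[OF W_D[OF assms(1)], of "{k}"] assms(2) r_pos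
  by (simp add: wip_self less_imp_le)

text \<open>The usual completeness proof for weighted square-summable sequences: coordinates
  converge, and the Cauchy estimate survives on every finite index set, hence on the whole
  sum.\<close>

lemma W_complete:
  assumes a: "\<And>n::nat. a n \<in> W"
    and Cauchy: "\<And>\<epsilon>. 0 < \<epsilon> \<Longrightarrow> \<exists>N. \<forall>m\<ge>N. \<forall>n\<ge>N. sqrt (wip (\<lambda>k. a m k - a n k) (\<lambda>k. a m k - a n k)) < \<epsilon>"
  shows "\<exists>b\<in>W. (\<lambda>n. sqrt (wip (\<lambda>k. a n k - b k) (\<lambda>k. a n k - b k))) \<longlonglongrightarrow> 0"
proof -
  have "convergent (\<lambda>n. a n k)" if k: "k \<in> I" for k
  proof (rule Cauchy_convergent, rule CauchyI)
    fix \<delta> :: real assume "0 < \<delta>"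
    have r: "0 < r k" by (rule r_pos[OF k])
    with \<open>0 < \<delta>\<close> obtain N where N: "\<And>m n. m \<ge> N \<Longrightarrow> n \<ge> N \<Longrightarrow>
        sqrt (wip (\<lambda>k. a m k - a n k) (\<lambda>k. a m k - a n k)) < \<delta> / sqrt (r k)"
      using Cauchy[of "\<delta> / sqrt (r k)"] by auto
    have "norm (a m k - a n k) < \<delta>" if "m \<ge> N" "n \<ge> N" for m n
    proof -
      have "sqrt ((a m k - a n k)\<^sup>2 / r k) < \<delta> / sqrt (r k)"
        using real_sqrt_le_mono[OF wip_coord[OF W_diff[OF a a] k, of m n]] N[OF that] by linarith
      then show ?thesis using r by (simp add: real_sqrt_divide divide_less_cancel)
    qed
    then show "\<exists>M. \<forall>m\<ge>M. \<forall>n\<ge>M. norm (a m k - a n k) < \<delta>" by blast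
  qed
  then have "\<forall>k\<in>I. \<exists>b. (\<lambda>n. a n k) \<longlonglongrightarrow> b" by (auto simp: convergent_def)
  then obtain b where b: "\<And>k. k \<in> I \<Longrightarrow> (\<lambda>n. a n k) \<longlonglongrightarrow> b k" by metis
  have tail: "\<exists>N. \<forall>n\<ge>N. (\<lambda>k. a n k - b k) \<in> W \<and> wip (\<lambda>k. a n k - b k) (\<lambda>k. a n k - b k) \<le> \<epsilon>\<^sup>2" if \<epsilon>: "0 < \<epsilon>" for \<epsilon>
  proof -
    obtain N where N: "\<And>m n. m \<ge> N \<Longrightarrow> n \<ge> N \<Longrightarrow> sqrt (wip (\<lambda>k. a m k - a n k) (\<lambda>k. a m k - a n k)) < \<epsilon>"
      using Cauchy[OF \<epsilon>] by blast
    have "(\<lambda>k. a n k - b k) \<in> W \<and> wip (\<lambda>k. a n k - b k) (\<lambda>k. a n k - b k) \<le> \<epsilon>\<^sup>2" if n: "n \<ge> N" for n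
    proof -
      have bd: "(\<Sum>k\<in>S. (a n k - b k)\<^sup>2 / r k) \<le> \<epsilon>\<^sup>2" if S: "finite S" "S \<subseteq> I" for S
      proof (rule LIMSEQ_le_const2)
        have "k \<in> S \<Longrightarrow> r k \<noteq> 0" for k using S(2) r_pos by force
        then show "(\<lambda>m. \<Sum>k\<in>S. (a n k - a m k)\<^sup>2 / r k) \<longlonglongrightarrow> (\<Sum>k\<in>S. (a n k - b k)\<^sup>2 / r k)"
          using S(2) by (intro tendsto_intros b) auto
        show "\<exists>N. \<forall>m\<ge>N. (\<Sum>k\<in>S. (a n k - a m k)\<^sup>2 / r k) \<le> \<epsilon>\<^sup>2"
        proof (intro exI allI impI)
          fix m assume m: "m \<ge> N"
          have "(\<Sum>k\<in>S. (a n k - a m k)\<^sup>2 / r k) \<le> wip (\<lambda>k. a n k - a m k) (\<lambda>k. a n k - a m k)"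
            unfolding wip_self using S r_pos
            by (intro finite_sum_le_infsum W_D[OF W_diff[OF a a]]) (auto simp: less_imp_le)
          also have "\<dots> = (sqrt (wip (\<lambda>k. a n k - a m k) (\<lambda>k. a n k - a m k)))\<^sup>2"
            using wip_nonneg by simp
          also have "\<dots> \<le> \<epsilon>\<^sup>2" using N[OF n m] wip_nonneg by (intro power_mono) auto
          finally show "(\<Sum>k\<in>S. (a n k - a m k)\<^sup>2 / r k) \<le> \<epsilon>\<^sup>2" .
        qed
      qed
      have "(\<lambda>k. (a n k - b k)\<^sup>2 / r k) summable_on I"
        using r_pos bd by (intro nonneg_bdd_above_summable_on) (auto intro!: bdd_aboveI simp: less_imp_le)
      then show ?thesis
        unfolding wip_self W_def using infsum_le_finite_sums[OF _ bd] by blast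
    qed
    then show ?thesis by blast
  qed
  obtain N where N: "(\<lambda>k. a N k - b k) \<in> W" using tail[of 1] by auto
  \<comment> \<open>Here \<open>b\<close> is written as \<open>a N\<close> minus
    \<open>a N - b\<close>, both square-summable with weight.\<close>
  have "b \<in> W" using W_diff[OF a[of N] N] by simp
  moreover have "(\<lambda>n. sqrt (wip (\<lambda>k. a n k - b k) (\<lambda>k. a n k - b k))) \<longlonglongrightarrow> 0"
  proof (rule LIMSEQ_I)
    fix \<delta> :: real assume "0 < \<delta>"
    obtain N where N: "\<And>n. n \<ge> N \<Longrightarrow> wip (\<lambda>k. a n k - b k) (\<lambda>k. a n k - b k) \<le> (\<delta> / 2)\<^sup>2"
      using tail[of "\<delta> / 2"] \<open>0 < \<delta>\<close> by auto
    have "sqrt (wip (\<lambda>k. a n k - b k) (\<lambda>k. a n k - b k)) < \<delta>" if "n \<ge> N" for n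
      using real_sqrt_le_mono[OF N[OF that]] \<open>0 < \<delta>\<close> by simp
    then show "\<exists>N. \<forall>n\<ge>N. norm (sqrt (wip (\<lambda>k. a n k - b k) (\<lambda>k. a n k - b k)) - 0) < \<delta>"
      using wip_nonneg by auto
  qed
  ultimately show ?thesis by blast
qed

text \<open>The functionals \<open>c\<close> recover the coefficients, so the inner product of two
  series is \<open>wip\<close> of their coefficients and every axiom becomes a statement about
  sequences. The reproducing property holds because the weight in the kernel cancels
  \<open>1 / r k\<close>.\<close>

theorem rkhs_series:
  assumes c: "\<And>a k. a \<in> W \<Longrightarrow> k \<in> I \<Longrightarrow> c (series a) k = a k"
  shows "rkhs X (series ` W) (\<lambda>f g. \<Sum>\<^sub>\<infinity>k\<in>I. 1 / r k * c f k * c g k) (\<lambda>x y. \<Sum>\<^sub>\<infinity>k\<in>I. r k * e k x * e k y)"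
proof -
  define ip where "ip = (\<lambda>f g. \<Sum>\<^sub>\<infinity>k\<in>I. 1 / r k * c f k * c g k)"
  have ip: "ip (series a) (series b) = wip a b" if "a \<in> W" "b \<in> W" for a b
    unfolding ip_def wip_def by (rule infsum_cong) (simp add: c that)
  have ker: "(\<lambda>x\<in>X. \<Sum>\<^sub>\<infinity>k\<in>I. r k * e k x * e k y) = series (\<lambda>k. r k * e k y)" for y
    unfolding series_def by (simp add: mult_ac)
  have "rkhs X (series ` W) ip (\<lambda>x y. \<Sum>\<^sub>\<infinity>k\<in>I. r k * e k x * e k y)"
  proof (rule rkhs.intro)
    show "series ` W \<subseteq> extensional X" by (auto simp: series_def)
    have "(\<lambda>x\<in>X. 0) = series (\<lambda>_. 0)" by (simp add: series_def)
    then show "(\<lambda>x\<in>X. 0) \<in> series ` W" using W_0 by simp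
  next
    fix f g assume "f \<in> series ` W" "g \<in> series ` W"
    then show "(\<lambda>x\<in>X. f x + g x) \<in> series ` W" by (auto simp: series_add W_add)
  next
    fix d f assume "f \<in> series ` W"
    then show "(\<lambda>x\<in>X. d * f x) \<in> series ` W" by (auto simp: series_scale W_scale)
  next
    fix f g assume "f \<in> series ` W" "g \<in> series ` W"
    show "ip f g = ip g f" unfolding ip_def by (simp add: mult_ac)
  next
    fix f g h assume "f \<in> series ` W" "g \<in> series ` W" "h \<in> series ` W"
    then obtain a b d where abd: "f = series a" "g = series b" "h = series d" "a \<in> W" "b \<in> W" "d \<in> W" by auto
    have "wip (\<lambda>k. a k + b k) d = wip a d + wip b d"
      unfolding wip_def by (simp add: algebra_simps add_divide_distrib flip: infsum_add)
        (use infsum_add[OF W_prod_summable[OF abd(4,6)] W_prod_summable[OF abd(5,6)]] in \<open>simp add: mult_ac\<close>)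
    then show "ip (\<lambda>x\<in>X. f x + g x) h = ip f h + ip g h"
      using abd by (simp add: ip series_add W_add)
  next
    fix d f g assume "f \<in> series ` W" "g \<in> series ` W"
    then obtain a b where ab: "f = series a" "g = series b" "a \<in> W" "b \<in> W" by auto
    have "wip (\<lambda>k. d * a k) b = d * wip a b"
      unfolding wip_def by (simp add: mult_ac flip: infsum_cmult_right')
    then show "ip (\<lambda>x\<in>X. d * f x) g = d * ip f g"
      using ab by (simp add: ip series_scale W_scale)
  next
    fix f assume "f \<in> series ` W"
    then show "0 \<le> ip f f" by (auto simp: ip wip_nonneg)
  next
    fix f assume "f \<in> series ` W" "ip f f = 0"
    then obtain a where a: "f = series a" "a \<in> W" "wip a a = 0" by (auto simp: ip)
    have "a k = 0" if "k \<in> I" for k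
      using wip_coord[OF a(2) that] a(3) r_pos[OF that] by (simp add: divide_le_0_iff)
    then have "(\<Sum>\<^sub>\<infinity>k\<in>I. a k * e k x) = 0" for x by (intro infsum_0) simp
    then show "f = (\<lambda>x\<in>X. 0)" by (simp add: a series_def)
  next
    fix F :: "nat \<Rightarrow> 'a \<Rightarrow> real"
    assume "F n \<in> series ` W" for n
    then have "\<forall>n. \<exists>a. F n = series a \<and> a \<in> W" by blast
    then obtain a where "\<forall>n. F n = series (a n) \<and> a n \<in> W" by (rule choice[THEN exE])
    then have F: "F = (\<lambda>n. series (a n))" and a: "a n \<in> W" for n by auto
    assume "\<exists>N. \<forall>m\<ge>N. \<forall>n\<ge>N. sqrt (ip (\<lambda>x\<in>X. F m x - F n x) (\<lambda>x\<in>X. F m x - F n x)) < e" if "0 < e" for e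
    then have "\<exists>N. \<forall>m\<ge>N. \<forall>n\<ge>N. sqrt (wip (\<lambda>k. a m k - a n k) (\<lambda>k. a m k - a n k)) < e" if "0 < e" for e
      using that unfolding F by (simp add: series_diff a ip W_diff)
    from W_complete[OF a this] obtain b where b: "b \<in> W"
      "(\<lambda>n. sqrt (wip (\<lambda>k. a n k - b k) (\<lambda>k. a n k - b k))) \<longlonglongrightarrow> 0" by blast
    then show "\<exists>f\<in>series ` W. (\<lambda>n. sqrt (ip (\<lambda>x\<in>X. F n x - f x) (\<lambda>x\<in>X. F n x - f x))) \<longlonglongrightarrow> 0"
      unfolding F by (intro bexI[of _ "series b"]) (simp_all add: series_diff a ip W_diff)
  next
    fix y assume "y \<in> X"
    then show "(\<lambda>x\<in>X. \<Sum>\<^sub>\<infinity>k\<in>I. r k * e k x * e k y) \<in> series ` W"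
      unfolding ker by (intro imageI W_kernel)
  next
    fix f y assume "f \<in> series ` W" and y: "y \<in> X"
    then obtain a where a: "f = series a" "a \<in> W" by auto
    have "wip a (\<lambda>k. r k * e k y) = (\<Sum>\<^sub>\<infinity>k\<in>I. a k * e k y)"
      unfolding wip_def by (rule infsum_cong) (use r_pos in force)
    then show "f y = ip f (\<lambda>x\<in>X. \<Sum>\<^sub>\<infinity>k\<in>I. r k * e k x * e k y)"
      unfolding ker using a y by (simp add: ip W_kernel) (simp add: series_def)
  qed
  then show ?thesis unfolding ip_def .
qed

end

section \<open>Orthonormal expansions and Monte Carlo variance\<close>

text \<open>Transfers termwise integration from sequences to unordered sums by enumerating
  \<open>I\<close>. Finite \<open>I\<close> is separate, since the enumeration is a bijection from
  all of \<open>nat\<close>.\<close>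

lemma integral_infsum:
  fixes g :: "'i \<Rightarrow> 'a \<Rightarrow> real"
  assumes "countable I"
    and int: "\<And>k. k \<in> I \<Longrightarrow> integrable M (g k)"
    and sum: "(\<lambda>k. LINT x|M. \<bar>g k x\<bar>) summable_on I"
    and pt: "\<And>x. x \<in> space M \<Longrightarrow> (\<lambda>k. g k x) summable_on I"
  shows "integrable M (\<lambda>x. \<Sum>\<^sub>\<infinity>k\<in>I. g k x)"
    and "(LINT x|M. (\<Sum>\<^sub>\<infinity>k\<in>I. g k x)) = (\<Sum>\<^sub>\<infinity>k\<in>I. LINT x|M. g k x)"
proof -
  have "integrable M (\<lambda>x. \<Sum>\<^sub>\<infinity>k\<in>I. g k x) \<and>
      (LINT x|M. (\<Sum>\<^sub>\<infinity>k\<in>I. g k x)) = (\<Sum>\<^sub>\<infinity>k\<in>I. LINT x|M. g k x)"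
  proof (cases "finite I")
    case True
    then show ?thesis using int by simp
  next
    case False
    define b where "b = from_nat_into I"
    have b: "bij_betw b UNIV I"
      unfolding b_def by (rule bij_betw_from_nat_into[OF \<open>countable I\<close> False])
    have bI: "b n \<in> I" for n using b by (auto simp: bij_betw_def)
    \<comment> \<open>Unordered summability of reals is absolute, so any enumeration gives the same
      sum.\<close>
    have seq: "summable (\<lambda>n. \<bar>h (b n)\<bar>) \<and> infsum h I = (\<Sum>n. h (b n))" if h: "h summable_on I" for h :: "'i \<Rightarrow> real"
    proof -
      have s: "(\<lambda>n. h (b n)) summable_on UNIV" using h by (simp add: summable_on_reindex_bij_betw[OF b])
      have "(\<lambda>n. norm (h (b n))) summable_on UNIV"
        by (rule summable_on_iff_abs_summable_on_real[THEN iffD1, OF s])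
      then have "summable (\<lambda>n. \<bar>h (b n)\<bar>)"
        by (auto dest!: has_sum_imp_sums[OF has_sum_infsum] sums_summable)
      moreover have "infsum h I = infsum (\<lambda>n. h (b n)) UNIV"
        by (rule infsum_reindex_bij_betw[OF b, symmetric])
      moreover have "\<dots> = (\<Sum>n. h (b n))"
        using has_sum_imp_sums[OF has_sum_infsum[OF s]] by (rule sums_unique)
      ultimately show ?thesis by simp
    qed
    have AE: "AE x in M. summable (\<lambda>n. norm (g (b n) x))"
      using seq[OF pt] by (intro AE_I2) simp
    have S: "summable (\<lambda>n. LINT x|M. norm (g (b n) x))"
      using seq[OF sum] by simp
    have eq: "x \<in> space M \<Longrightarrow> (\<Sum>\<^sub>\<infinity>k\<in>I. g k x) = (\<Sum>n. g (b n) x)" for x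
      using seq[OF pt] by simp
    have "(\<lambda>k. norm (LINT x|M. g k x)) summable_on I"
      by (rule Infinite_Sum.abs_summable_on_comparison_test'[OF sum])
        (use integral_norm_bound[of M] in auto)
    then have sI: "(\<lambda>k. LINT x|M. g k x) summable_on I"
      by (rule abs_summable_summable)
    have "integrable M (\<lambda>x. \<Sum>\<^sub>\<infinity>k\<in>I. g k x) \<longleftrightarrow> integrable M (\<lambda>x. \<Sum>n. g (b n) x)"
      by (rule Bochner_Integration.integrable_cong) (simp_all add: eq)
    moreover have "integrable M (\<lambda>x. \<Sum>n. g (b n) x)"
      by (rule integrable_suminf[OF int[OF bI] AE S])
    moreover have "(LINT x|M. (\<Sum>\<^sub>\<infinity>k\<in>I. g k x)) = (LINT x|M. (\<Sum>n. g (b n) x))"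
      by (rule Bochner_Integration.integral_cong) (simp_all add: eq)
    moreover have "\<dots> = (\<Sum>n. LINT x|M. g (b n) x)"
      by (rule integral_suminf[OF int[OF bI] AE S])
    ultimately show ?thesis using seq[OF sI] by simp
  qed
  then show "integrable M (\<lambda>x. \<Sum>\<^sub>\<infinity>k\<in>I. g k x)"
    and "(LINT x|M. (\<Sum>\<^sub>\<infinity>k\<in>I. g k x)) = (\<Sum>\<^sub>\<infinity>k\<in>I. LINT x|M. g k x)" by auto
qed

lemma infsum_delta:
  fixes c :: "'i \<Rightarrow> real"
  assumes "l \<in> I"
  shows "(\<Sum>\<^sub>\<infinity>k\<in>I. if k = l then c k else 0) = c l"
proof -
  have "(\<Sum>\<^sub>\<infinity>k\<in>I. if k = l then c k else 0) = infsum c {l}"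
    by (rule infsum_cong_neutral) (use assms in auto)
  then show ?thesis by simp
qed

text \<open>Absolutely summable coefficients, together with the uniform bound on the integrals of
  \<open>\<bar>e k x * e l x\<bar>\<close>, justify every interchange of sum and integral. Pointwise
  summability makes \<open>f\<close> a genuine sum at every point.\<close>

locale orthonormal_expansion =
  fixes M :: "'a measure" and I :: "'i set" and e :: "'i \<Rightarrow> 'a \<Rightarrow> real" and a :: "'i \<Rightarrow> real"
  assumes countable: "countable I"
    and integrable_prod: "\<And>k l. k \<in> I \<Longrightarrow> l \<in> I \<Longrightarrow> integrable M (\<lambda>x. e k x * e l x)"
    and orthonormal: "\<And>k l. k \<in> I \<Longrightarrow> l \<in> I \<Longrightarrow> (LINT x|M. e k x * e l x) = (if k = l then 1 else 0)"
    and coeffs_summable: "(\<lambda>k. \<bar>a k\<bar>) summable_on I"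
    and pointwise_summable: "\<And>x. x \<in> space M \<Longrightarrow> (\<lambda>k. a k * e k x) summable_on I"
begin

definition f :: "'a \<Rightarrow> real" where
  "f x = (\<Sum>\<^sub>\<infinity>k\<in>I. a k * e k x)"

text \<open>The product is dominated by the mean of the two squares, each of integral 1.\<close>

lemma integral_abs_prod_le_1:
  assumes "k \<in> I" "l \<in> I"
  shows "(LINT x|M. \<bar>e k x * e l x\<bar>) \<le> 1"
proof -
  have "(LINT x|M. \<bar>e k x * e l x\<bar>) \<le> (LINT x|M. (e k x * e k x + e l x * e l x) / 2)"
  proof (rule integral_mono)
    fix x
    show "\<bar>e k x * e l x\<bar> \<le> (e k x * e k x + e l x * e l x) / 2"
      using zero_le_power2[of "\<bar>e k x\<bar> - \<bar>e l x\<bar>"] by (simp add: power2_eq_square abs_mult algebra_simps)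
  qed (use assms integrable_prod in \<open>auto intro!: integrable_abs integrable_add\<close>)
  also have "\<dots> = 1"
    using assms by (simp add: integrable_prod orthonormal)
  finally show ?thesis .
qed

lemma summable_integral_abs:
  assumes "l \<in> I"
  shows "(\<lambda>k. LINT x|M. \<bar>a k * (e k x * e l x)\<bar>) summable_on I"
    and "(\<Sum>\<^sub>\<infinity>k\<in>I. LINT x|M. \<bar>a k * (e k x * e l x)\<bar>) \<le> (\<Sum>\<^sub>\<infinity>k\<in>I. \<bar>a k\<bar>)"
proof -
  have le: "(LINT x|M. \<bar>a k * (e k x * e l x)\<bar>) \<le> \<bar>a k\<bar>" if "k \<in> I" for k
    using mult_left_mono[OF integral_abs_prod_le_1[OF that assms], of "\<bar>a k\<bar>"] by (simp add: abs_mult)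
  have "(\<lambda>k. norm (LINT x|M. \<bar>a k * (e k x * e l x)\<bar>)) summable_on I"
    by (rule Infinite_Sum.abs_summable_on_comparison_test'[OF coeffs_summable]) (use le in simp)
  then show s: "(\<lambda>k. LINT x|M. \<bar>a k * (e k x * e l x)\<bar>) summable_on I"
    by (rule abs_summable_summable)
  show "(\<Sum>\<^sub>\<infinity>k\<in>I. LINT x|M. \<bar>a k * (e k x * e l x)\<bar>) \<le> (\<Sum>\<^sub>\<infinity>k\<in>I. \<bar>a k\<bar>)"
    by (rule infsum_mono[OF s coeffs_summable le])
qed

lemma pointwise_summable_prod:
  assumes "x \<in> space M"
  shows "(\<lambda>k. a k * (e k x * e l x)) summable_on I"
  using summable_on_cmult_left[OF pointwise_summable[OF assms], of "e l x"] by (simp add: mult.assoc)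

lemma f_mult: "f x * e l x = (\<Sum>\<^sub>\<infinity>k\<in>I. a k * (e k x * e l x))"
  unfolding f_def by (simp add: infsum_cmult_left' mult.assoc[symmetric])

lemma integrable_f_mult:
  assumes "l \<in> I"
  shows "integrable M (\<lambda>x. f x * e l x)"
  unfolding f_mult
  by (intro integral_infsum(1) countable integrable_mult_right integrable_prod assms
      summable_integral_abs(1) pointwise_summable_prod)

lemma integral_f_mult:
  assumes "l \<in> I"
  shows "(LINT x|M. f x * e l x) = a l"
proof -
  have "(LINT x|M. f x * e l x) = (\<Sum>\<^sub>\<infinity>k\<in>I. LINT x|M. a k * (e k x * e l x))"
    unfolding f_mult
    by (intro integral_infsum(2) countable integrable_mult_right integrable_prod assms
      summable_integral_abs(1) pointwise_summable_prod)
  also have "\<dots> = (\<Sum>\<^sub>\<infinity>k\<in>I. if k = l then a k else 0)"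
    by (rule infsum_cong) (simp add: orthonormal assms)
  also have "\<dots> = a l" by (rule infsum_delta[OF assms])
  finally show ?thesis .
qed

lemma integral_abs_f_mult_le:
  assumes "l \<in> I"
  shows "(LINT x|M. \<bar>f x * e l x\<bar>) \<le> (\<Sum>\<^sub>\<infinity>k\<in>I. \<bar>a k\<bar>)"
proof -
  have pt: "(\<lambda>k. norm (a k * (e k x * e l x))) summable_on I" if "x \<in> space M" for x
    by (rule summable_on_iff_abs_summable_on_real[THEN iffD1, OF pointwise_summable_prod[OF that]])
  note abs_infsum = integral_infsum[of I M "\<lambda>k x. \<bar>a k * (e k x * e l x)\<bar>", OF countable]
  have "(LINT x|M. \<bar>f x * e l x\<bar>) \<le> (LINT x|M. (\<Sum>\<^sub>\<infinity>k\<in>I. \<bar>a k * (e k x * e l x)\<bar>))"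
  proof (rule integral_mono)
    show "integrable M (\<lambda>x. \<bar>f x * e l x\<bar>)" by (intro integrable_abs integrable_f_mult assms)
    show "integrable M (\<lambda>x. \<Sum>\<^sub>\<infinity>k\<in>I. \<bar>a k * (e k x * e l x)\<bar>)"
      using pt by (intro abs_infsum(1) integrable_abs integrable_mult_right integrable_prod assms)
        (use summable_integral_abs(1)[OF assms] in \<open>simp_all\<close>)
    show "\<bar>f x * e l x\<bar> \<le> (\<Sum>\<^sub>\<infinity>k\<in>I. \<bar>a k * (e k x * e l x)\<bar>)" if "x \<in> space M" for x
      unfolding f_mult using norm_infsum_bound[OF pt[OF that]] by simp
  qed
  also have "\<dots> = (\<Sum>\<^sub>\<infinity>k\<in>I. LINT x|M. \<bar>a k * (e k x * e l x)\<bar>)"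
    using pt by (intro abs_infsum(2) integrable_abs integrable_mult_right integrable_prod assms)
      (use summable_integral_abs(1)[OF assms] in \<open>simp_all\<close>)
  also have "\<dots> \<le> (\<Sum>\<^sub>\<infinity>k\<in>I. \<bar>a k\<bar>)" by (rule summable_integral_abs(2)[OF assms])
  finally show ?thesis .
qed

lemma f_square: "(f x)\<^sup>2 = (\<Sum>\<^sub>\<infinity>l\<in>I. a l * (f x * e l x))"
proof -
  have "(\<Sum>\<^sub>\<infinity>l\<in>I. a l * (f x * e l x)) = (\<Sum>\<^sub>\<infinity>l\<in>I. a l * e l x * f x)"
    by (simp add: mult_ac)
  then show ?thesis
    by (simp add: infsum_cmult_left' f_def power2_eq_square)
qed

text \<open>One factor of the square is expanded and integrated termwise against the other;
  \<open>integral_abs_f_mult_le\<close> bounds the \<open>l\<close>-th absolute integral by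
  \<open>\<bar>a l\<bar>\<close> times a constant independent of \<open>l\<close>.\<close>

lemma Parseval:
  shows "integrable M (\<lambda>x. (f x)\<^sup>2)" and "(LINT x|M. (f x)\<^sup>2) = (\<Sum>\<^sub>\<infinity>k\<in>I. (a k)\<^sup>2)"
proof -
  define A where "A = (\<Sum>\<^sub>\<infinity>k\<in>I. \<bar>a k\<bar>)"
  have le: "(LINT x|M. \<bar>a l * (f x * e l x)\<bar>) \<le> \<bar>a l\<bar> * A" if "l \<in> I" for l
    using mult_left_mono[OF integral_abs_f_mult_le[OF that], of "\<bar>a l\<bar>"] by (simp add: abs_mult A_def)
  have "(\<lambda>l. norm (LINT x|M. \<bar>a l * (f x * e l x)\<bar>)) summable_on I"
    by (rule Infinite_Sum.abs_summable_on_comparison_test'[OF summable_on_cmult_left[OF coeffs_summable, of A]])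
      (use le in simp)
  then have s: "(\<lambda>l. LINT x|M. \<bar>a l * (f x * e l x)\<bar>) summable_on I"
    by (rule abs_summable_summable)
  have pt: "(\<lambda>l. a l * (f x * e l x)) summable_on I" if "x \<in> space M" for x
    using summable_on_cmult_left[OF pointwise_summable[OF that], of "f x"] by (simp add: mult_ac)
  show "integrable M (\<lambda>x. (f x)\<^sup>2)"
    unfolding f_square by (intro integral_infsum(1) countable integrable_mult_right integrable_f_mult s pt)
  have "(LINT x|M. (f x)\<^sup>2) = (\<Sum>\<^sub>\<infinity>l\<in>I. LINT x|M. a l * (f x * e l x))"
    unfolding f_square by (intro integral_infsum(2) countable integrable_mult_right integrable_f_mult s pt)
  also have "\<dots> = (\<Sum>\<^sub>\<infinity>l\<in>I. (a l)\<^sup>2)"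
    by (rule infsum_cong) (simp add: integral_f_mult power2_eq_square)
  finally show "(LINT x|M. (f x)\<^sup>2) = (\<Sum>\<^sub>\<infinity>k\<in>I. (a k)\<^sup>2)" .
qed

end

text \<open>After centering, the squared error is a double sum; independence kills the off-diagonal
  terms, and \<open>n\<close> equal diagonal terms remain against \<open>1 / n^2\<close>.\<close>

lemma (in prob_space) monte_carlo_variance:
  fixes f :: "'a \<Rightarrow> real"
  assumes f: "integrable M f" and f2: "integrable M (\<lambda>x. (f x)\<^sup>2)" and n: "1 \<le> n"
  shows "(LINT x|(\<Pi>\<^sub>M i\<in>{1..n}. M). \<bar>expectation f - 1 / real n * (\<Sum>i=1..n. f (x i))\<bar>\<^sup>2) = variance f / real n"
proof -
  interpret P: product_sigma_finite "\<lambda>_::nat. M" by unfold_locales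
  define g where "g = (\<lambda>x. f x - expectation f)"
  have g: "integrable M g" "expectation g = 0"
    using f by (auto simp: g_def prob_space)
  have "integrable M (\<lambda>x. (f x)\<^sup>2 - 2 * expectation f * f x + (expectation f)\<^sup>2)"
    by (intro Bochner_Integration.integrable_add Bochner_Integration.integrable_diff f2 integrable_mult_right f) simp
  then have g2: "integrable M (\<lambda>x. g x * g x)"
    by (simp add: g_def power2_eq_square algebra_simps)
  \<comment> \<open>Writes \<open>g (x i) * g (x j)\<close> as a product of one-coordinate factors,
    the form that product integration accepts. The two conditionals together give \<open>g\<close>
    squared when \<open>i = j\<close>.\<close>
  define h where "h = (\<lambda>i j (l::nat) x. (if l = i then g x else 1) * (if l = j then g x else (1::real)))"
  have h: "integrable M (h i j l)" for i j l :: nat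
    using g(1) g2 by (cases "l = i"; cases "l = j") (simp_all add: h_def)
  have prod: "(\<Prod>l\<in>{1..n}. h i j l (x l)) = g (x i) * g (x j)" if "i \<in> {1..n}" "j \<in> {1..n}" for i j x
    unfolding h_def prod.distrib using that by simp
  have int_ij: "integrable (\<Pi>\<^sub>M i\<in>{1..n}. M) (\<lambda>x. g (x i) * g (x j))" if "i \<in> {1..n}" "j \<in> {1..n}" for i j
    using P.product_integrable_prod[of "{1..n}" "h i j", OF finite_atLeastAtMost h]
    unfolding prod[OF that] .
  have ij: "(LINT x|(\<Pi>\<^sub>M i\<in>{1..n}. M). g (x i) * g (x j)) = (if i = j then variance f else 0)"
    if "i \<in> {1..n}" "j \<in> {1..n}" for i j
  proof -
    have "(LINT x|(\<Pi>\<^sub>M i\<in>{1..n}. M). g (x i) * g (x j)) = (\<Prod>l\<in>{1..n}. expectation (h i j l))"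
      using P.product_integral_prod[of "{1..n}" "h i j", OF finite_atLeastAtMost h]
      unfolding prod[OF that] .
    also have "\<dots> = (if i = j then variance f else 0)"
    proof (cases "i = j")
      case True
      have "expectation (h i j l) = (if l = i then variance f else 1)" for l
        using True by (simp add: h_def g_def power2_eq_square prob_space)
      then show ?thesis using True that by simp
    next
      case False
      then have "expectation (h i j i) = 0" using g(2) by (simp add: h_def)
      then have "(\<Prod>l\<in>{1..n}. expectation (h i j l)) = 0" using that by (intro prod_zero) auto
      then show ?thesis using False by simp
    qed
    finally show ?thesis .
  qed
  have "\<bar>expectation f - 1 / real n * (\<Sum>i=1..n. f (x i))\<bar>\<^sup>2 =
      1 / (real n)\<^sup>2 * (\<Sum>i=1..n. \<Sum>j=1..n. g (x i) * g (x j))" for x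
  proof -
    have "expectation f - 1 / real n * (\<Sum>i=1..n. f (x i)) = - (1 / real n * (\<Sum>i=1..n. g (x i)))"
      using n by (simp add: g_def sum_subtractf field_simps)
    then show ?thesis
      by (simp add: power_mult_distrib power2_eq_square sum_product)
  qed
  then have "(LINT x|(\<Pi>\<^sub>M i\<in>{1..n}. M). \<bar>expectation f - 1 / real n * (\<Sum>i=1..n. f (x i))\<bar>\<^sup>2) =
      (LINT x|(\<Pi>\<^sub>M i\<in>{1..n}. M). 1 / (real n)\<^sup>2 * (\<Sum>i=1..n. \<Sum>j=1..n. g (x i) * g (x j)))"
    by simp
  also have "\<dots> = 1 / (real n)\<^sup>2 * (\<Sum>i=1..n. \<Sum>j=1..n. if i = j then variance f else 0)"
  proof -
    have "(LINT x|(\<Pi>\<^sub>M i\<in>{1..n}. M). (\<Sum>i=1..n. \<Sum>j=1..n. g (x i) * g (x j))) =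
        (\<Sum>i=1..n. LINT x|(\<Pi>\<^sub>M i\<in>{1..n}. M). (\<Sum>j=1..n. g (x i) * g (x j)))"
      by (intro Bochner_Integration.integral_sum Bochner_Integration.integrable_sum int_ij)
    also have "\<dots> = (\<Sum>i=1..n. \<Sum>j=1..n. LINT x|(\<Pi>\<^sub>M i\<in>{1..n}. M). g (x i) * g (x j))"
      by (intro sum.cong Bochner_Integration.integral_sum int_ij refl)
    also have "\<dots> = (\<Sum>i=1..n. \<Sum>j=1..n. if i = j then variance f else 0)"
      by (intro sum.cong refl ij)
    finally show ?thesis by (simp only: integral_mult_right_zero)
  qed
  also have "\<dots> = variance f / real n"
    by (simp add: power2_eq_square)
  finally show ?thesis .
qed

section \<open>Gaussian measure and product weights\<close>

interpretation lborel_product: product_sigma_finite "\<lambda>_::nat. lborel :: real measure"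
  by unfold_locales

lemma space_leb [simp]: "space (leb s) = Rspace s"
  by (simp add: leb_def Rspace_def space_PiM)

lemma gauss_density_eq_prod: "gauss_density s x = (\<Prod>j=1..s. std_normal_density (x j))"
proof -
  have "(2 * pi) powr (- real s / 2) = ((2 * pi) powr (- 1 / 2)) powr real s"
    by (simp add: powr_powr)
  also have "\<dots> = ((2 * pi) powr (- (1 / 2))) ^ s"
    by (simp add: powr_realpow)
  also have "\<dots> = (1 / sqrt (2 * pi)) ^ s"
    by (simp add: powr_minus powr_half_sqrt inverse_eq_divide)
  finally have "(2 * pi) powr (- real s / 2) = (1 / sqrt (2 * pi)) ^ s" .
  moreover have "exp (- (\<Sum>j=1..s. x j * x j) / 2) = (\<Prod>j=1..s. exp (- (x j)\<^sup>2 / 2))"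
    by (simp add: exp_sum[symmetric] sum_negf sum_divide_distrib power2_eq_square)
  ultimately show ?thesis
    by (simp only: gauss_density_def std_normal_density_def prod.distrib prod_constant) simp
qed

lemma borel_measurable_prod_components:
  assumes "\<And>j. j \<in> {1..s} \<Longrightarrow> f j \<in> borel_measurable borel"
  shows "(\<lambda>x. \<Prod>j=1..s. f j (x j) :: real) \<in> borel_measurable (leb s)"
  unfolding leb_def
  by (intro borel_measurable_prod measurable_compose[OF measurable_component_singleton]) (use assms in auto)

lemma borel_measurable_gauss_density [measurable]: "gauss_density s \<in> borel_measurable (leb s)"
  unfolding gauss_density_eq_prod[abs_def] by (rule borel_measurable_prod_components) simp

lemma borel_measurable_hermite_multi [measurable]: "hermite_multi s k \<in> borel_measurable (leb s)"
  unfolding hermite_multi_def[abs_def] by (rule borel_measurable_prod_components) simp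

lemma gauss_density_nonneg [simp]: "0 \<le> gauss_density s x"
  by (simp add: gauss_density_def)

lemma space_std_normal [simp]: "space (std_normal s) = Rspace s"
  by (simp add: std_normal_def)

lemma borel_measurable_std_normal_iff [simp]: "f \<in> borel_measurable (std_normal s) \<longleftrightarrow> f \<in> borel_measurable (leb s)"
  by (simp add: std_normal_def)

lemma integrable_std_normal:
  fixes f :: "(nat \<Rightarrow> real) \<Rightarrow> real"
  assumes "f \<in> borel_measurable (leb s)"
  shows "integrable (std_normal s) f \<longleftrightarrow> integrable (leb s) (\<lambda>x. gauss_density s x * f x)"
  unfolding std_normal_def using assms by (subst integrable_density) auto

lemma integral_std_normal:
  fixes f :: "(nat \<Rightarrow> real) \<Rightarrow> real"
  assumes "f \<in> borel_measurable (leb s)"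
  shows "(LINT x|std_normal s. f x) = (LINT x|leb s. gauss_density s x * f x)"
  unfolding std_normal_def using assms by (subst integral_density) auto

lemma prob_space_std_normal: "prob_space (std_normal s)"
proof
  have int: "integrable (leb s) (gauss_density s)"
    unfolding gauss_density_eq_prod[abs_def] leb_def
    by (intro lborel_product.product_integrable_prod) auto
  have "(LINT x|leb s. gauss_density s x) = (\<Prod>j\<in>{1..s}. LINT x|lborel. std_normal_density x)"
    unfolding gauss_density_eq_prod leb_def
    by (intro lborel_product.product_integral_prod) auto
  also have "\<dots> = 1"
    by simp
  finally have "(LINT x|leb s. gauss_density s x) = 1" .
  then show "emeasure (std_normal s) (space (std_normal s)) = 1"
    using int unfolding std_normal_def
    by (subst emeasure_density) (auto simp: nn_integral_eq_integral simp flip: space_leb cong: nn_integral_cong)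
qed

lemma hermite_multi_orthonormal:
  assumes "k \<in> multi_index s" "l \<in> multi_index s"
  shows "integrable (std_normal s) (\<lambda>x. hermite_multi s k x * hermite_multi s l x)"
    and "(LINT x|std_normal s. hermite_multi s k x * hermite_multi s l x) = (if k = l then 1 else 0)"
proof -
  have eq: "gauss_density s x * (hermite_multi s k x * hermite_multi s l x) =
     (\<Prod>j=1..s. std_normal_density (x j) * (hermite (k j) (x j) * hermite (l j) (x j)))" for x
    by (simp add: gauss_density_eq_prod hermite_multi_def prod.distrib)
  have m: "(\<lambda>x. hermite_multi s k x * hermite_multi s l x) \<in> borel_measurable (leb s)"
    by measurable
  show "integrable (std_normal s) (\<lambda>x. hermite_multi s k x * hermite_multi s l x)"
    unfolding integrable_std_normal[OF m] eq unfolding leb_def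
    by (intro lborel_product.product_integrable_prod hermite_orthonormal) simp
  have "(LINT x|std_normal s. hermite_multi s k x * hermite_multi s l x) =
      (\<Prod>j\<in>{1..s}. LINT x|lborel. std_normal_density x * (hermite (k j) x * hermite (l j) x))"
    unfolding integral_std_normal[OF m] eq unfolding leb_def
    by (intro lborel_product.product_integral_prod hermite_orthonormal) simp
  also have "\<dots> = (\<Prod>j\<in>{1..s}. if k j = l j then 1 else 0)"
    by (simp only: hermite_orthonormal(2))
  also have "\<dots> = (if k = l then 1 else 0)"
  proof (cases "k = l")
    case False
    \<comment> \<open>Both indices are \<open>undefined\<close> off \<open>{1..s}\<close>, so they
      must differ inside; that coordinate contributes a zero factor.\<close>
    then obtain j where "j \<in> {1..s}" "k j \<noteq> l j"
      using assms unfolding multi_index_def by (metis PiE_ext)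
    then have "(\<Prod>j\<in>{1..s}. if k j = l j then 1 else 0 :: real) = 0"
      by (intro prod_zero) auto
    with False show ?thesis by simp
  qed simp
  finally show "(LINT x|std_normal s. hermite_multi s k x * hermite_multi s l x) = (if k = l then 1 else 0)" .
qed

text \<open>Restricted to \<open>{1..s}\<close> because members of \<open>multi_index s\<close> are
  \<open>undefined\<close> elsewhere.\<close>

definition multi_zero :: "nat \<Rightarrow> nat \<Rightarrow> nat" where
  "multi_zero s = (\<lambda>j\<in>{1..s}. 0)"

lemma multi_zero_in [simp]: "multi_zero s \<in> multi_index s"
  by (simp add: multi_zero_def multi_index_def)

lemma hermite_multi_zero [simp]: "hermite_multi s (multi_zero s) x = 1"
  by (simp add: hermite_multi_def multi_zero_def)

lemma countable_multi_index: "countable (multi_index s)"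
  unfolding multi_index_def by (intro countable_PiE) auto

text \<open>A finite set of index functions lies in the finite box of its coordinate projections,
  and the sum over a box factors. The product of the coordinate sums thus bounds all finite partial
  sums.\<close>

lemma summable_on_prod_PiE:
  fixes f :: "'i \<Rightarrow> 'b \<Rightarrow> real"
  assumes "finite A" and nonneg: "\<And>x y. x \<in> A \<Longrightarrow> y \<in> B x \<Longrightarrow> 0 \<le> f x y"
    and "\<And>x. x \<in> A \<Longrightarrow> f x summable_on B x"
  shows "(\<lambda>g. \<Prod>x\<in>A. f x (g x)) summable_on (PiE A B)"
proof (rule nonneg_bdd_above_summable_on)
  show "0 \<le> (\<Prod>x\<in>A. f x (g x))" if "g \<in> PiE A B" for g
    using that nonneg by (intro prod_nonneg) auto
  show "bdd_above (sum (\<lambda>g. \<Prod>x\<in>A. f x (g x)) ` {F. F \<subseteq> PiE A B \<and> finite F})"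
  proof (rule bdd_aboveI)
    fix t assume "t \<in> sum (\<lambda>g. \<Prod>x\<in>A. f x (g x)) ` {F. F \<subseteq> PiE A B \<and> finite F}"
    then obtain F where F: "F \<subseteq> PiE A B" "finite F" "t = (\<Sum>g\<in>F. \<Prod>x\<in>A. f x (g x))" by auto
    define P where "P = (\<lambda>x. (\<lambda>g. g x) ` F)"
    have P: "finite (P x)" "x \<in> A \<Longrightarrow> P x \<subseteq> B x" for x using F(1,2) by (auto simp: P_def)
    have "F \<subseteq> PiE A P" using F(1) by (auto simp: P_def PiE_iff extensional_def)
    moreover have "0 \<le> (\<Prod>x\<in>A. f x (g x))" if "g \<in> PiE A P" for g
      using that P(2) by (intro prod_nonneg nonneg ballI) blast+
    ultimately have "t \<le> (\<Sum>g\<in>PiE A P. \<Prod>x\<in>A. f x (g x))"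
      unfolding F(3) using P(1) assms(1) by (intro sum_mono2 finite_PiE) auto
    also have "\<dots> = (\<Prod>x\<in>A. \<Sum>y\<in>P x. f x y)"
      using prod_sum_PiE[OF assms(1), of P f] P(1) by simp
    also have "\<dots> \<le> (\<Prod>x\<in>A. infsum (f x) (B x))"
      using P(1) assms(3)
      by (intro prod_mono conjI sum_nonneg finite_sum_le_infsum)
        (auto intro!: nonneg intro: subsetD[OF P(2)])
    finally show "t \<le> (\<Prod>x\<in>A. infsum (f x) (B x))" .
  qed
qed

section \<open>Summability and maximum of the finite-smoothness weights\<close>

lemma finite_smoothness1_pos: "0 < g \<Longrightarrow> 0 < finite_smoothness1 \<alpha> g k"
  by (simp add: finite_smoothness1_def)

lemma summable_on_finite_smoothness1:
  assumes "1 < \<alpha>" and bound: "\<And>k. \<bar>c k\<bar> \<le> C"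
  shows "(\<lambda>k. finite_smoothness1 \<alpha> g k * c k) summable_on UNIV"
proof (rule norm_summable_imp_summable_on, rule summable_comparison_test_ev)
  have "0 \<le> C" using order_trans[OF abs_ge_zero bound] .
  \<comment> \<open>The comparison starts at \<open>k = 1\<close>: at 0 the weight is 1, while
    \<open>0 powr (- \<alpha>)\<close> is 0.\<close>
  have "norm (norm (finite_smoothness1 \<alpha> g k * c k)) \<le> \<bar>g\<bar> * real k powr (- \<alpha>) * C" if "k \<ge> 1" for k
    using that \<open>0 \<le> C\<close> by (auto simp: finite_smoothness1_def abs_mult intro!: mult_mono bound)
  then show "eventually (\<lambda>k. norm (norm (finite_smoothness1 \<alpha> g k * c k)) \<le> \<bar>g\<bar> * real k powr (- \<alpha>) * C) sequentially"
    unfolding eventually_sequentially by blast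
  show "summable (\<lambda>k. \<bar>g\<bar> * real k powr (- \<alpha>) * C)"
    using assms(1) by (intro summable_mult summable_mult2) (simp add: summable_real_powr_iff)
qed

context
  fixes \<alpha> :: real and \<gamma> :: "nat \<Rightarrow> real" and s :: nat
  assumes \<alpha>: "1 < \<alpha>" and \<gamma>: "\<And>j. 1 \<le> j \<Longrightarrow> 0 < \<gamma> j"
begin

lemma finite_smoothness_pos: "0 < finite_smoothness \<alpha> \<gamma> s k"
  unfolding finite_smoothness_def using \<gamma> by (intro prod_pos finite_smoothness1_pos) auto

text \<open>For fixed \<open>x\<close> the sum factors over coordinates, and in each
  \<open>hermite_bounded\<close> leaves a multiple of the convergent series of
  \<open>k powr (- \<alpha>)\<close>.\<close>

lemma finite_smoothness_kernel_summable:
  "(\<lambda>k. finite_smoothness \<alpha> \<gamma> s k * (hermite_multi s k x)\<^sup>2) summable_on multi_index s"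
proof -
  have "(\<lambda>k. \<Prod>j\<in>{1..s}. finite_smoothness1 \<alpha> (\<gamma> j) (k j) * (hermite (k j) (x j))\<^sup>2) summable_on multi_index s"
    unfolding multi_index_def
  proof (rule summable_on_prod_PiE)
    fix j assume "j \<in> {1..s}"
    obtain C where "\<And>k. (hermite k (x j))\<^sup>2 \<le> C" using hermite_bounded by blast
    then show "(\<lambda>k. finite_smoothness1 \<alpha> (\<gamma> j) k * (hermite k (x j))\<^sup>2) summable_on UNIV"
      by (intro summable_on_finite_smoothness1[OF \<alpha>, of _ C]) simp
  qed (use finite_smoothness1_pos[OF \<gamma>] in \<open>auto simp: less_imp_le\<close>)
  then show ?thesis
    by (simp add: finite_smoothness_def hermite_multi_def prod.distrib prod_power_distrib)
qed

lemma finite_smoothness_summable: "finite_smoothness \<alpha> \<gamma> s summable_on multi_index s"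
proof -
  have "(\<lambda>k. \<Prod>j\<in>{1..s}. finite_smoothness1 \<alpha> (\<gamma> j) (k j)) summable_on multi_index s"
    unfolding multi_index_def
    by (rule summable_on_prod_PiE)
      (use finite_smoothness1_pos[OF \<gamma>] summable_on_finite_smoothness1[OF \<alpha>, of "\<lambda>_. 1" 1]
        in \<open>auto simp: less_imp_le\<close>)
  then show ?thesis
    by (simp add: finite_smoothness_def[abs_def])
qed

lemma finite_smoothness_le: "finite_smoothness \<alpha> \<gamma> s k \<le> (\<Prod>j=1..s. max (\<gamma> j) 1)"
  unfolding finite_smoothness_def
proof (intro prod_mono conjI)
  fix j assume "j \<in> {1..s}"
  then have "0 < \<gamma> j" using \<gamma> by simp
  then show "0 \<le> finite_smoothness1 \<alpha> (\<gamma> j) (k j)" by (simp add: less_imp_le finite_smoothness1_pos)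
  show "finite_smoothness1 \<alpha> (\<gamma> j) (k j) \<le> max (\<gamma> j) 1"
  proof (cases "k j = 0")
    case False
    then have "real (k j) powr (- \<alpha>) \<le> 1 powr (- \<alpha>)"
      using \<alpha> by (intro powr_mono2') auto
    then have "\<gamma> j * real (k j) powr (- \<alpha>) \<le> \<gamma> j"
      using \<open>0 < \<gamma> j\<close> by (simp add: mult_left_le)
    then show ?thesis using False by (simp add: finite_smoothness1_def)
  qed (simp add: finite_smoothness1_def)
qed

text \<open>Degree 1 gives the factor \<open>\<gamma> j\<close>, degree 0 the factor 1, so the
  larger can be chosen in each coordinate. The hypothesis on \<open>\<gamma> 1\<close> makes the
  resulting index nonzero.\<close>

lemma finite_smoothness_attains:
  assumes "1 \<le> s" "1 < \<gamma> 1"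
  obtains k where "k \<in> multi_index s" "k \<noteq> multi_zero s"
    "finite_smoothness \<alpha> \<gamma> s k = (\<Prod>j=1..s. max (\<gamma> j) 1)"
proof
  let ?k = "\<lambda>j\<in>{1..s}. if 1 < \<gamma> j then 1 else 0 :: nat"
  show "?k \<in> multi_index s" by (simp add: multi_index_def)
  have "?k 1 \<noteq> multi_zero s 1" using assms by (simp add: multi_zero_def)
  then show "?k \<noteq> multi_zero s" by metis
  show "finite_smoothness \<alpha> \<gamma> s ?k = (\<Prod>j=1..s. max (\<gamma> j) 1)"
    unfolding finite_smoothness_def by (rule prod.cong) (auto simp: finite_smoothness1_def max_def)
qed

end

section \<open>The Monte Carlo error in Hermite spaces\<close>

text \<open>Kernel convergence at each point yields the function space; summability of the weight
  itself yields absolutely summable coefficients, as \<open>orthonormal_expansion\<close>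
  demands.\<close>

locale hermite_rkhs =
  fixes s :: nat and r :: "(nat \<Rightarrow> nat) \<Rightarrow> real"
  assumes weight_pos: "\<And>k. k \<in> multi_index s \<Longrightarrow> 0 < r k"
    and weight_summable: "r summable_on multi_index s"
    and hermite_kernel_summable:
      "\<And>x. x \<in> Rspace s \<Longrightarrow> (\<lambda>k. r k * (hermite_multi s k x)\<^sup>2) summable_on multi_index s"
begin

sublocale weighted_series "Rspace s" "multi_index s" "hermite_multi s" r
  by unfold_locales (use weight_pos hermite_kernel_summable in auto)

sublocale prob_space "std_normal s"
  by (rule prob_space_std_normal)

text \<open>Either \<open>\<bar>a k\<bar>\<close> is at most \<open>r k\<close>, or it is at most
  its square divided by \<open>r k\<close>; both majorants are summable.\<close>

lemma W_abs_summable: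
  assumes "a \<in> W"
  shows "(\<lambda>k. \<bar>a k\<bar>) summable_on multi_index s"
proof -
  have "(\<lambda>k. norm (a k)) summable_on multi_index s"
  proof (rule Infinite_Sum.abs_summable_on_comparison_test'[OF summable_on_add[OF W_D[OF assms] weight_summable]])
    fix k assume "k \<in> multi_index s"
    then have r: "0 < r k" by (rule weight_pos)
    show "norm (a k) \<le> (a k)\<^sup>2 / r k + r k"
    proof (cases "\<bar>a k\<bar> \<le> r k")
      case True
      then show ?thesis using r by (simp add: add_increasing)
    next
      case False
      then have "\<bar>a k\<bar> * r k \<le> \<bar>a k\<bar> * \<bar>a k\<bar>" by (intro mult_left_mono) auto
      then have "\<bar>a k\<bar> \<le> (a k)\<^sup>2 / r k" using r by (simp add: pos_le_divide_eq power2_eq_square)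
      then show ?thesis using r by simp
    qed
  qed
  then show ?thesis by simp
qed

lemma expansion:
  assumes "a \<in> W"
  shows "orthonormal_expansion (std_normal s) (multi_index s) (hermite_multi s) a"
  by unfold_locales
    (use assms in \<open>auto simp: countable_multi_index hermite_multi_orthonormal W_abs_summable
      intro: series_summable\<close>)

lemma series_eq:
  assumes "a \<in> W" "x \<in> Rspace s"
  shows "series a x = orthonormal_expansion.f (multi_index s) (hermite_multi s) a x"
  using assms by (simp add: series_def orthonormal_expansion.f_def[OF expansion])

context
  fixes a assumes a: "a \<in> W"
begin

interpretation E: orthonormal_expansion "std_normal s" "multi_index s" "hermite_multi s" a
  by (rule expansion[OF a])

text \<open>The mean is the coefficient at the zero index, whose basis function is 1; the second
  moment is Parseval's identity. The function \<open>series a\<close> is \<open>undefined\<close>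
  off \<open>Rspace s\<close>, so it is replaced by the total function \<open>E.f\<close> on the
  space of the measure.\<close>

lemma integrable_series: "integrable (std_normal s) (series a)"
  and integral_series: "(LINT x|std_normal s. series a x) = a (multi_zero s)"
  and integrable_series_square: "integrable (std_normal s) (\<lambda>x. (series a x)\<^sup>2)"
  and integral_series_square: "(LINT x|std_normal s. (series a x)\<^sup>2) = (\<Sum>\<^sub>\<infinity>k\<in>multi_index s. (a k)\<^sup>2)"
proof -
  have eq: "x \<in> space (std_normal s) \<Longrightarrow> series a x = E.f x" for x
    by (simp add: series_eq[OF a])
  show "integrable (std_normal s) (series a)"
    using E.integrable_f_mult[OF multi_zero_in]
    by (subst Bochner_Integration.integrable_cong[OF refl eq]) simp_all
  show "(LINT x|std_normal s. series a x) = a (multi_zero s)"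
    using E.integral_f_mult[OF multi_zero_in]
    by (subst Bochner_Integration.integral_cong[OF refl eq]) simp_all
  show "integrable (std_normal s) (\<lambda>x. (series a x)\<^sup>2)"
    using E.Parseval(1)
    by (subst Bochner_Integration.integrable_cong[OF refl, of _ _ "\<lambda>x. (E.f x)\<^sup>2"]) (simp_all add: eq)
  show "(LINT x|std_normal s. (series a x)\<^sup>2) = (\<Sum>\<^sub>\<infinity>k\<in>multi_index s. (a k)\<^sup>2)"
    using E.Parseval(2)
    by (subst Bochner_Integration.integral_cong[OF refl, of _ _ "\<lambda>x. (E.f x)\<^sup>2"]) (simp_all add: eq)
qed

text \<open>Supplies the recovery hypothesis of \<open>rkhs_series\<close>.\<close>

lemma hermite_coeff_series:
  assumes k: "k \<in> multi_index s"
  shows "hermite_coeff s (series a) k = a k"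
proof -
  have m: "(\<lambda>x. E.f x * hermite_multi s k x) \<in> borel_measurable (leb s)"
    using borel_measurable_integrable[OF E.integrable_f_mult[OF k]] by simp
  have "hermite_coeff s (series a) k = (LINT x|leb s. gauss_density s x * (E.f x * hermite_multi s k x))"
    unfolding hermite_coeff_def
    by (rule Bochner_Integration.integral_cong) (simp_all add: series_eq[OF a])
  also have "\<dots> = (LINT x|std_normal s. E.f x * hermite_multi s k x)"
    by (rule integral_std_normal[OF m, symmetric])
  also have "\<dots> = a k" by (rule E.integral_f_mult[OF k])
  finally show ?thesis .
qed

lemma gauss_int_series: "gauss_int s (series a) = expectation (series a)"
  unfolding gauss_int_def using borel_measurable_integrable[OF integrable_series]
  by (subst integral_std_normal) (simp_all add: mult.commute)

text \<open>Second moment minus squared mean removes exactly the zero coefficient from Parseval's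
  sum.\<close>

lemma mc_variance_series:
  assumes "1 \<le> n"
  shows "(LINT x|(\<Pi>\<^sub>M i\<in>{1..n}. std_normal s). \<bar>gauss_int s (series a) - mc_rule n x (series a)\<bar>\<^sup>2) =
     ((\<Sum>\<^sub>\<infinity>k\<in>multi_index s. (a k)\<^sup>2) - (a (multi_zero s))\<^sup>2) / real n"
proof -
  have "(LINT x|(\<Pi>\<^sub>M i\<in>{1..n}. std_normal s). \<bar>gauss_int s (series a) - mc_rule n x (series a)\<bar>\<^sup>2) =
      variance (series a) / real n"
    unfolding gauss_int_series mc_rule_def
    by (rule monte_carlo_variance[OF integrable_series integrable_series_square assms])
  also have "variance (series a) = (\<Sum>\<^sub>\<infinity>k\<in>multi_index s. (a k)\<^sup>2) - (a (multi_zero s))\<^sup>2"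
    unfolding variance_eq[OF integrable_series integrable_series_square]
    by (simp only: integral_series integral_series_square)
  finally show ?thesis .
qed

lemma hermite_norm_series: "hermite_norm s r (series a) = sqrt (wip a a)"
proof -
  have "hermite_inner s r (series a) (series a) = wip a a"
    unfolding hermite_inner_def wip_def by (rule infsum_cong) (simp add: hermite_coeff_series)
  then show ?thesis by (simp add: hermite_norm_def)
qed

end

text \<open>Resolves the definite description: \<open>rkhs_series\<close> provides a space, and
  \<open>rkhs_unique\<close> shows that every other candidate equals it.\<close>

lemma hermite_space_eq: "hermite_space s r = series ` W"
proof -
  have "hermite_inner s r = (\<lambda>f g. \<Sum>\<^sub>\<infinity>k\<in>multi_index s. 1 / r k * hermite_coeff s f k * hermite_coeff s g k)"
    by (intro ext) (simp add: hermite_inner_def)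
  moreover have "hermite_kernel s r = (\<lambda>x y. \<Sum>\<^sub>\<infinity>k\<in>multi_index s. r k * hermite_multi s k x * hermite_multi s k y)"
    by (intro ext) (simp add: hermite_kernel_def)
  ultimately have rkhs: "rkhs (Rspace s) (series ` W) (hermite_inner s r) (hermite_kernel s r)"
    using rkhs_series[of "hermite_coeff s", OF hermite_coeff_series] by simp
  then show ?thesis
    unfolding hermite_space_def by (rule the_equality) (rule rkhs_unique[OF _ rkhs])
qed

lemma mc_error_eq:
  assumes "1 \<le> n"
  shows "mc_error s r n = (SUP a\<in>{a \<in> W. wip a a \<le> 1}.
     ereal (sqrt (((\<Sum>\<^sub>\<infinity>k\<in>multi_index s. (a k)\<^sup>2) - (a (multi_zero s))\<^sup>2) / real n)))"
proof -
  have "{f \<in> hermite_space s r. hermite_norm s r f \<le> 1} = series ` {a \<in> W. wip a a \<le> 1}"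
    unfolding hermite_space_eq by (auto simp: hermite_norm_series)
  then have "mc_error s r n = (SUP a\<in>{a \<in> W. wip a a \<le> 1}. ereal (sqrt
      (LINT x|(\<Pi>\<^sub>M i\<in>{1..n}. std_normal s). \<bar>gauss_int s (series a) - mc_rule n x (series a)\<bar>\<^sup>2)))"
    unfolding mc_error_def by (simp only: image_image)
  also have "\<dots> = (SUP a\<in>{a \<in> W. wip a a \<le> 1}.
     ereal (sqrt (((\<Sum>\<^sub>\<infinity>k\<in>multi_index s. (a k)\<^sup>2) - (a (multi_zero s))\<^sup>2) / real n)))"
    by (intro SUP_cong refl) (simp only: mem_Collect_eq mc_variance_series[OF _ assms])
  finally show ?thesis .
qed

text \<open>On the unit ball the plain sum of squares is at most \<open>R\<close> times the weighted
  one; the subtracted zero coefficient is simply discarded.\<close>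

lemma mc_error_le:
  assumes "1 \<le> n" and R: "\<And>k. k \<in> multi_index s \<Longrightarrow> r k \<le> R"
  shows "mc_error s r n \<le> ereal (sqrt (R / real n))"
  unfolding mc_error_eq[OF assms(1)]
proof (rule SUP_least)
  fix a assume "a \<in> {a \<in> W. wip a a \<le> 1}"
  then have a: "a \<in> W" "wip a a \<le> 1" by auto
  have le: "(a k)\<^sup>2 \<le> R * ((a k)\<^sup>2 / r k)" if "k \<in> multi_index s" for k
  proof -
    have "r k * ((a k)\<^sup>2 / r k) \<le> R * ((a k)\<^sup>2 / r k)"
      using weight_pos[OF that] R[OF that] by (intro mult_right_mono) auto
    then show ?thesis using weight_pos[OF that] by simp
  qed
  have s: "(\<lambda>k. R * ((a k)\<^sup>2 / r k)) summable_on multi_index s"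
    by (intro summable_on_cmult_right W_D a)
  have "(\<lambda>k. norm ((a k)\<^sup>2)) summable_on multi_index s"
    by (rule Infinite_Sum.abs_summable_on_comparison_test'[OF s]) (use le in simp)
  then have s': "(\<lambda>k. (a k)\<^sup>2) summable_on multi_index s" by simp
  have "0 < R" using weight_pos[OF multi_zero_in] R[OF multi_zero_in] by simp
  have "(\<Sum>\<^sub>\<infinity>k\<in>multi_index s. (a k)\<^sup>2) \<le> (\<Sum>\<^sub>\<infinity>k\<in>multi_index s. R * ((a k)\<^sup>2 / r k))"
    by (rule infsum_mono[OF s' s le])
  also have "\<dots> = R * wip a a" unfolding wip_self by (rule infsum_cmult_right')
  also have "\<dots> \<le> R" using a(2) \<open>0 < R\<close> by (simp add: mult_left_le)
  finally have "(\<Sum>\<^sub>\<infinity>k\<in>multi_index s. (a k)\<^sup>2) - (a (multi_zero s))\<^sup>2 \<le> R"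
    using zero_le_power2[of "a (multi_zero s)"] by linarith
  then show "ereal (sqrt (((\<Sum>\<^sub>\<infinity>k\<in>multi_index s. (a k)\<^sup>2) - (a (multi_zero s))\<^sup>2) / real n)) \<le> ereal (sqrt (R / real n))"
    by (simp add: divide_right_mono)
qed

text \<open>The witness is the normalized basis function \<open>sqrt (r k) H\<^sub>k\<close>.\<close>

lemma mc_error_ge:
  assumes "1 \<le> n" and k: "k \<in> multi_index s" "k \<noteq> multi_zero s"
  shows "ereal (sqrt (r k / real n)) \<le> mc_error s r n"
proof -
  define a where "a = (\<lambda>l. if l = k then sqrt (r k) else 0)"
  have r: "0 < r k" by (rule weight_pos[OF k(1)])
  have sq: "(a l)\<^sup>2 = (if l = k then r k else 0)" "(a l)\<^sup>2 / r l = (if l = k then 1 else 0)" for l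
    using r by (auto simp: a_def)
  have "(\<lambda>l. if l = k then 1 else 0 :: real) summable_on multi_index s \<longleftrightarrow> (\<lambda>_. 1 :: real) summable_on {k}"
    by (rule summable_on_cong_neutral) (use k in auto)
  then have W: "a \<in> W" unfolding W_def mem_Collect_eq sq(2) by simp
  have wip: "wip a a = 1" unfolding wip_self sq(2) by (rule infsum_delta[OF k(1)])
  have sum: "(\<Sum>\<^sub>\<infinity>l\<in>multi_index s. (a l)\<^sup>2) = r k" unfolding sq(1) by (rule infsum_delta[OF k(1)])
  have "(a (multi_zero s))\<^sup>2 = 0" using k(2) by (simp add: a_def)
  then show ?thesis
    unfolding mc_error_eq[OF assms(1)] using W wip sum by (intro SUP_upper2[of a]) auto
qed

text \<open>An admissible sample size must be exhibited before the least one satisfies its own error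
  bound; that bound, tested on a single basis function, then gives the lower estimate.\<close>

lemma n_mc_bounds:
  assumes \<epsilon>: "0 < \<epsilon>" "\<epsilon> < 1" and R: "\<And>k. k \<in> multi_index s \<Longrightarrow> r k \<le> R" and "1 \<le> R"
  shows "1 \<le> n_mc s r \<epsilon>" and "real (n_mc s r \<epsilon>) \<le> 2 * R / \<epsilon>\<^sup>2"
    and "k \<in> multi_index s \<Longrightarrow> k \<noteq> multi_zero s \<Longrightarrow> r k / \<epsilon>\<^sup>2 \<le> real (n_mc s r \<epsilon>)"
proof -
  define P where "P = (\<lambda>n. 1 \<le> n \<and> mc_error s r n \<le> ereal \<epsilon>)"
  \<comment> \<open>Rounding up adds at most 1, which is at most \<open>R\<close> divided by the
    square of \<open>\<epsilon>\<close> since \<open>1 \<le> R\<close> and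
    \<open>\<epsilon> < 1\<close>; hence the factor 2.\<close>
  define n where "n = nat \<lceil>R / \<epsilon>\<^sup>2\<rceil>"
  have e2: "0 < \<epsilon>\<^sup>2" "\<epsilon>\<^sup>2 \<le> 1" using \<epsilon> by (auto simp: power_le_one)
  have one: "1 \<le> R / \<epsilon>\<^sup>2" using e2 \<open>1 \<le> R\<close> by (simp add: pos_le_divide_eq)
  have n_ge: "R / \<epsilon>\<^sup>2 \<le> real n" unfolding n_def by (rule real_nat_ceiling_ge)
  then have n1: "1 \<le> n" using one by linarith
  have "real n \<le> R / \<epsilon>\<^sup>2 + 1" using one unfolding n_def by linarith
  then have n_le: "real n \<le> 2 * R / \<epsilon>\<^sup>2" using one by simp
  have "R / real n \<le> \<epsilon>\<^sup>2"
    using n_ge n1 e2 by (simp add: pos_divide_le_eq mult.commute)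
  then have "sqrt (R / real n) \<le> \<epsilon>"
    using real_sqrt_le_mono[of "R / real n" "\<epsilon>\<^sup>2"] \<epsilon> by simp
  then have "P n" unfolding P_def using n1 mc_error_le[OF n1 R] order_trans by fastforce
  then have "P (n_mc s r \<epsilon>)" and le: "n_mc s r \<epsilon> \<le> n"
    unfolding n_mc_def P_def by (rule LeastI, rule Least_le)
  then have P: "1 \<le> n_mc s r \<epsilon>" "mc_error s r (n_mc s r \<epsilon>) \<le> ereal \<epsilon>" by (auto simp: P_def)
  show "1 \<le> n_mc s r \<epsilon>" by fact
  show "real (n_mc s r \<epsilon>) \<le> 2 * R / \<epsilon>\<^sup>2" using le n_le by linarith
  assume k: "k \<in> multi_index s" "k \<noteq> multi_zero s"
  have "sqrt (r k / real (n_mc s r \<epsilon>)) \<le> \<epsilon>"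
    using order_trans[OF mc_error_ge[OF P(1) k] P(2)] by simp
  then have "r k / real (n_mc s r \<epsilon>) \<le> \<epsilon>\<^sup>2" by (rule sqrt_le_D)
  then show "r k / \<epsilon>\<^sup>2 \<le> real (n_mc s r \<epsilon>)"
    using P(1) e2 by (simp add: pos_divide_le_eq mult.commute)
qed

end

text \<open>\<open>exp S\<close> is the product of the \<open>max (\<gamma> j) 1\<close>, hence an
  upper bound for all weights. The lower bound gives up its dependence on \<open>\<epsilon>\<close>,
  because necessity of the growth conditions is tested at \<open>\<epsilon> = 1/2\<close>
  only.\<close>

lemma n_mc_finite_smoothness_bounds:
  fixes \<alpha> :: real and \<gamma> :: "nat \<Rightarrow> real"
  assumes \<alpha>: "1 < \<alpha>" and \<gamma>: "\<And>j. 1 \<le> j \<Longrightarrow> 0 < \<gamma> j" and dec: "\<And>j. 1 \<le> j \<Longrightarrow> \<gamma> (Suc j) \<le> \<gamma> j"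
    and s: "1 \<le> s" and \<epsilon>: "0 < \<epsilon>" "\<epsilon> < 1"
  defines "S \<equiv> \<Sum>j=1..s. max (ln (\<gamma> j)) 0"
  shows "1 \<le> n_mc s (finite_smoothness \<alpha> \<gamma> s) \<epsilon>"
    and "real (n_mc s (finite_smoothness \<alpha> \<gamma> s) \<epsilon>) \<le> 2 * exp S / \<epsilon>\<^sup>2"
    and "exp S \<le> real (n_mc s (finite_smoothness \<alpha> \<gamma> s) \<epsilon>)"
proof -
  interpret hermite_rkhs s "finite_smoothness \<alpha> \<gamma> s"
    by unfold_locales
      (use finite_smoothness_pos[OF \<alpha> \<gamma>] finite_smoothness_summable[OF \<alpha> \<gamma>]
        finite_smoothness_kernel_summable[OF \<alpha> \<gamma>] in auto)
  have S: "exp S = (\<Prod>j=1..s. max (\<gamma> j) 1)"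
  proof -
    have "exp (max (ln (\<gamma> j)) 0) = max (\<gamma> j) 1" if "1 \<le> j" for j
      using \<gamma>[OF that] by (auto simp: max_def ln_le_zero_iff not_le intro: antisym)
    then show ?thesis unfolding S_def by (simp add: exp_sum)
  qed
  have "0 \<le> S" unfolding S_def by (intro sum_nonneg) simp
  then have "1 \<le> exp S" by simp
  have bd: "finite_smoothness \<alpha> \<gamma> s k \<le> exp S" for k
    unfolding S by (rule finite_smoothness_le[OF \<alpha> \<gamma>])
  note bounds = n_mc_bounds[OF \<epsilon> bd \<open>1 \<le> exp S\<close>]
  show one: "1 \<le> n_mc s (finite_smoothness \<alpha> \<gamma> s) \<epsilon>" by (rule bounds(1))
  show "real (n_mc s (finite_smoothness \<alpha> \<gamma> s) \<epsilon>) \<le> 2 * exp S / \<epsilon>\<^sup>2" by (rule bounds(2))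
  show "exp S \<le> real (n_mc s (finite_smoothness \<alpha> \<gamma> s) \<epsilon>)"
  proof (cases "1 < \<gamma> 1")
    case True
    from finite_smoothness_attains[where \<alpha> = \<alpha> and \<gamma> = \<gamma> and s = s, OF \<alpha> \<gamma> s True] obtain k where
      k: "k \<in> multi_index s" "k \<noteq> multi_zero s" "finite_smoothness \<alpha> \<gamma> s k = exp S"
      unfolding S by blast
    have "exp S \<le> exp S / \<epsilon>\<^sup>2"
      using \<epsilon> by (simp add: pos_le_divide_eq power_le_one)
    also have "\<dots> \<le> real (n_mc s (finite_smoothness \<alpha> \<gamma> s) \<epsilon>)"
      using bounds(3)[OF k(1,2)] k(3) by simp
    finally show ?thesis .
  next
    case False
    have "\<gamma> j \<le> \<gamma> 1" if "1 \<le> j" for j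
      using that by (induction j rule: dec_induct) (use dec order_trans in blast)+
    then have "max (\<gamma> j) 1 = 1" if "1 \<le> j" for j using False that by (simp add: max_def) fastforce
    then have "exp S = 1" unfolding S by simp
    then show ?thesis using one by simp
  qed
qed

section \<open>Tractability\<close>

lemma le_ln_of_exp_le: "exp x \<le> y \<Longrightarrow> x \<le> ln (y::real)"
  using ln_ge_iff[of y x] less_le_trans[OF exp_gt_zero] by blast

text \<open>The Hermite spaces affect tractability only through these two-sided bounds, so the three
  criteria become facts about partial sums of a nonnegative sequence.\<close>

locale exponential_mc_bounds =
  fixes r :: "nat \<Rightarrow> (nat \<Rightarrow> nat) \<Rightarrow> real" and b :: "nat \<Rightarrow> real"
  assumes b_nonneg: "\<And>j. 0 \<le> b j"
    and n_ge_1: "\<And>s \<epsilon>. 1 \<le> s \<Longrightarrow> 0 < \<epsilon> \<Longrightarrow> \<epsilon> < 1 \<Longrightarrow> 1 \<le> n_mc s (r s) \<epsilon>"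
    and n_le: "\<And>s \<epsilon>. 1 \<le> s \<Longrightarrow> 0 < \<epsilon> \<Longrightarrow> \<epsilon> < 1 \<Longrightarrow> real (n_mc s (r s) \<epsilon>) \<le> 2 * exp (\<Sum>j=1..s. b j) / \<epsilon>\<^sup>2"
    and n_ge: "\<And>s \<epsilon>. 1 \<le> s \<Longrightarrow> 0 < \<epsilon> \<Longrightarrow> \<epsilon> < 1 \<Longrightarrow> exp (\<Sum>j=1..s. b j) \<le> real (n_mc s (r s) \<epsilon>)"
begin

definition S :: "nat \<Rightarrow> real" where
  "S s = (\<Sum>j=1..s. b j)"

lemma S_mono: "s \<le> t \<Longrightarrow> S s \<le> S t"
  unfolding S_def using b_nonneg by (intro sum_mono2) auto

lemma S_nonneg: "0 \<le> S s"
  unfolding S_def using b_nonneg by (intro sum_nonneg)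

lemma powr_minus_2: "0 < (\<epsilon>::real) \<Longrightarrow> \<epsilon> powr - 2 = 1 / \<epsilon>\<^sup>2"
  by (simp add: powr_minus inverse_eq_divide powr_numeral)

text \<open>At \<open>\<epsilon> = 1/2\<close> the assumed bound is independent of \<open>s\<close>
  and bounds all partial sums. Conversely, bounded \<open>S\<close> gives exponent 2 in
  \<open>1 / \<epsilon>\<close>.\<close>

lemma strongly_polynomially_iff:
  "strongly_polynomially_mc_tractable r \<longleftrightarrow> summable (\<lambda>j. b (Suc j))"
proof
  assume "strongly_polynomially_mc_tractable r"
  then obtain c p where c: "0 < c" and n: "\<And>s \<epsilon>. 1 \<le> s \<Longrightarrow> \<epsilon> \<in> {0<..<1} \<Longrightarrow> real (n_mc s (r s) \<epsilon>) \<le> c * \<epsilon> powr (- p)"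
    unfolding strongly_polynomially_mc_tractable_def by blast
  define D where "D = c * (1/2) powr (- p)"
  have "S s \<le> ln D" if "1 \<le> s" for s
  proof -
    have "exp (S s) \<le> D"
      using n_ge[OF that, of "1/2"] n[OF that, of "1/2"] by (simp add: S_def D_def)
    then show ?thesis by (rule le_ln_of_exp_le)
  qed
  then have "S s \<le> ln D" for s
    using order_trans[OF S_mono[of s "Suc s"]] by simp
  moreover have "(\<Sum>i<m. b (Suc i)) = S m" for m
    unfolding S_def by (simp add: sum.atLeast1_atMost_eq)
  ultimately show "summable (\<lambda>j. b (Suc j))"
    using b_nonneg by (intro summableI_nonneg_bounded[of _ "ln D"]) auto
next
  assume sm: "summable (\<lambda>j. b (Suc j))"
  define B where "B = (\<Sum>j. b (Suc j))"
  have "S s \<le> B" for s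
    unfolding S_def B_def using sum_le_suminf[OF sm, of "{..<s}"] b_nonneg
    by (simp add: sum.atLeast1_atMost_eq)
  then have "real (n_mc s (r s) \<epsilon>) \<le> 2 * exp B * \<epsilon> powr - 2" if "1 \<le> s" "\<epsilon> \<in> {0<..<1}" for s \<epsilon>
  proof -
    have "real (n_mc s (r s) \<epsilon>) \<le> 2 * exp (S s) / \<epsilon>\<^sup>2"
      using n_le[OF that(1), of \<epsilon>] that(2) by (simp add: S_def)
    also have "\<dots> \<le> 2 * exp B / \<epsilon>\<^sup>2"
      using \<open>S s \<le> B\<close> by (intro divide_right_mono) auto
    finally show ?thesis using that(2) by (simp add: powr_minus_2)
  qed
  then show "strongly_polynomially_mc_tractable r"
    unfolding strongly_polynomially_mc_tractable_def
    by (intro exI[of _ "2 * exp B"] exI[of _ 2]) auto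
qed

lemma polynomially_iff:
  "polynomially_mc_tractable r \<longleftrightarrow> limsup (\<lambda>s. ereal (S s / ln (real s))) < \<infinity>"
proof
  assume "polynomially_mc_tractable r"
  then obtain c p q where c: "0 < c" "0 < q"
    and n: "\<And>s \<epsilon>. 1 \<le> s \<Longrightarrow> \<epsilon> \<in> {0<..<1} \<Longrightarrow> real (n_mc s (r s) \<epsilon>) \<le> c * real s powr q * \<epsilon> powr (- p)"
    unfolding polynomially_mc_tractable_def by blast
  define D where "D = c * (1/2) powr (- p)"
  have D: "0 < D" using c by (simp add: D_def)
  \<comment> \<open>From \<open>s = 3\<close> on, \<open>ln s\<close> is at least 1 because
    \<open>exp 1 \<le> 3\<close>, so the constant \<open>ln D\<close> can be absorbed into a
    multiple of \<open>ln s\<close>.\<close>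
  have "S s / ln (real s) \<le> \<bar>ln D\<bar> + q" if s: "3 \<le> s" for s
  proof -
    have "exp (S s) \<le> D * real s powr q"
      using n_ge[of s "1/2"] n[of s "1/2"] s by (simp add: S_def D_def mult_ac)
    then have "S s \<le> ln (D * real s powr q)"
      by (rule le_ln_of_exp_le)
    then have le: "S s \<le> ln D + q * ln (real s)"
      using D s by (simp add: ln_mult ln_powr)
    have "exp 1 \<le> real s" using s exp_le by linarith
    then have ln1: "1 \<le> ln (real s)" using s by (subst ln_ge_iff) auto
    have "\<bar>ln D\<bar> * 1 \<le> \<bar>ln D\<bar> * ln (real s)" using ln1 by (intro mult_left_mono) auto
    then have "S s \<le> (\<bar>ln D\<bar> + q) * ln (real s)" using le by (simp add: distrib_right)
    then show ?thesis using ln1 by (simp add: pos_divide_le_eq)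
  qed
  then have "limsup (\<lambda>s. ereal (S s / ln (real s))) \<le> ereal (\<bar>ln D\<bar> + q)"
    by (intro Limsup_bounded eventually_sequentiallyI[of 3]) simp
  then show "limsup (\<lambda>s. ereal (S s / ln (real s))) < \<infinity>"
    by (rule le_less_trans) simp
next
  assume "limsup (\<lambda>s. ereal (S s / ln (real s))) < \<infinity>"
  then have "limsup (\<lambda>s. ereal (S s / ln (real s))) \<noteq> \<infinity>" by simp
  then obtain B :: nat where "limsup (\<lambda>s. ereal (S s / ln (real s))) < ereal (real B)"
    unfolding less_PInf_Ex_of_nat by (rule exE)
  from Limsup_lessD[OF this] obtain N where N: "\<And>s. N \<le> s \<Longrightarrow> S s / ln (real s) < real B"
    unfolding eventually_sequentially by auto
  \<comment> \<open>The added 1 keeps the exponent positive even if \<open>B = 0\<close>.\<close>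
  define q where "q = real B + 1"
  \<comment> \<open>The shift by 2 ensures \<open>ln s > 0\<close>, so the quotient bound can be
    multiplied out. The finitely many smaller \<open>s\<close> are covered by monotonicity of
    \<open>S\<close> and the constant \<open>exp (S (N + 2))\<close>.\<close>
  have S_le: "exp (S s) \<le> exp (S (N + 2)) * real s powr q" if s: "1 \<le> s" for s
  proof (cases "N + 2 \<le> s")
    case True
    then have ln: "0 < ln (real s)" by simp
    have "S s \<le> real B * ln (real s)"
      using N[of s] True ln by (simp add: pos_divide_less_eq)
    also have "\<dots> \<le> q * ln (real s)" using ln by (simp add: q_def distrib_right)
    finally have "exp (S s) \<le> real s powr q"
      using s by (simp add: powr_def)
    also have "\<dots> \<le> exp (S (N + 2)) * real s powr q"
      using mult_right_mono[of 1 "exp (S (N + 2))" "real s powr q"] S_nonneg[of "N + 2"] by simp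
    finally show ?thesis .
  next
    case False
    then have "exp (S s) \<le> exp (S (N + 2))" using S_mono[of s "N + 2"] by simp
    moreover have "1 \<le> real s powr q" using s by (intro ge_one_powr_ge_zero) (auto simp: q_def)
    ultimately show ?thesis
      using mult_mono[of "exp (S s)" "exp (S (N + 2))" 1 "real s powr q"] by simp
  qed
  have "real (n_mc s (r s) \<epsilon>) \<le> 2 * exp (S (N + 2)) * real s powr q * \<epsilon> powr - 2"
    if "1 \<le> s" "\<epsilon> \<in> {0<..<1}" for s \<epsilon>
  proof -
    have "real (n_mc s (r s) \<epsilon>) \<le> 2 * exp (S s) / \<epsilon>\<^sup>2"
      using n_le[OF that(1), of \<epsilon>] that(2) by (simp add: S_def)
    also have "\<dots> \<le> 2 * (exp (S (N + 2)) * real s powr q) / \<epsilon>\<^sup>2"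
      using S_le[OF that(1)] by (intro divide_right_mono) auto
    finally show ?thesis using that(2) by (simp add: powr_minus_2)
  qed
  moreover have "0 < q" by (simp add: q_def add_nonneg_pos)
  ultimately show "polynomially_mc_tractable r"
    unfolding polynomially_mc_tractable_def
    by (intro exI[of _ "2 * exp (S (N + 2))"] exI[of _ 2] exI[of _ q]) auto
qed

text \<open>Necessity restricts the limit to the path \<open>\<epsilon> = 1/2\<close>. For
  sufficiency, \<open>ln n\<close> is at most \<open>ln 2 + S s - 2 * ln \<epsilon>\<close>; each
  variable term is a small multiple of \<open>s\<close> or \<open>1 / \<epsilon>\<close> plus a
  constant, uniformly in the other variable.\<close>

lemma weakly_iff:
  "weakly_mc_tractable r \<longleftrightarrow> (\<lambda>s. S s / real s) \<longlonglongrightarrow> 0"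
proof
  let ?F = "inf (filtercomap (\<lambda>(s::nat, \<epsilon>::real). real s + 1 / \<epsilon>) at_top) (principal ({1..} \<times> {0<..<1}))"
  assume "weakly_mc_tractable r"
  moreover have "filterlim (\<lambda>s. (s, 1/2)) ?F sequentially"
    unfolding filterlim_inf filterlim_principal filterlim_filtercomap_iff
  proof
    show "filterlim ((\<lambda>(s, \<epsilon>). real s + 1 / \<epsilon>) \<circ> (\<lambda>s. (s, 1/2))) at_top sequentially"
      unfolding o_def prod.case
      by (rule filterlim_at_top_mono[OF filterlim_real_sequentially]) simp
    show "eventually (\<lambda>s. (s, 1/2) \<in> {1..} \<times> {0<..<1::real}) sequentially"
      using eventually_ge_at_top[of 1] by (rule eventually_mono) auto
  qed
  ultimately have "((\<lambda>s. ln (real (n_mc s (r s) (1/2))) / (real s + 2)) \<longlongrightarrow> 0) sequentially"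
    unfolding weakly_mc_tractable_def by (drule_tac filterlim_compose) (auto simp: o_def)
  then have lim: "(\<lambda>s. 3 * (ln (real (n_mc s (r s) (1/2))) / (real s + 2))) \<longlonglongrightarrow> 0"
    by (rule tendsto_mult_right_zero)
  \<comment> \<open>The factor 3 converts the denominator: \<open>s + 2 \<le> 3 * s\<close> for
    \<open>s \<ge> 1\<close>.\<close>
  have "norm (S s / real s) \<le> 3 * (ln (real (n_mc s (r s) (1/2))) / (real s + 2))" if s: "1 \<le> s" for s
  proof -
    define L where "L = ln (real (n_mc s (r s) (1/2)))"
    have SL: "S s \<le> L"
      unfolding L_def using n_ge[OF s, of "1/2"] by (intro le_ln_of_exp_le) (simp add: S_def)
    then have "0 \<le> L" using S_nonneg[of s] by linarith
    have "S s / real s \<le> L / real s" using SL by (intro divide_right_mono) auto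
    also have "\<dots> = 3 * (L / (3 * real s))" using s by simp
    also have "\<dots> \<le> 3 * (L / (real s + 2))"
      using s \<open>0 \<le> L\<close> by (intro mult_left_mono divide_left_mono) auto
    finally show ?thesis using S_nonneg[of s] by (simp add: L_def)
  qed
  then show "(\<lambda>s. S s / real s) \<longlonglongrightarrow> 0"
    by (intro Lim_null_comparison[OF eventually_sequentiallyI lim]) 
next
  assume lim: "(\<lambda>s. S s / real s) \<longlonglongrightarrow> 0"
  show "weakly_mc_tractable r"
    unfolding weakly_mc_tractable_def
  proof (rule tendstoI)
    fix \<delta> :: real assume \<delta>: "0 < \<delta>"
    from LIMSEQ_D[OF lim, of "\<delta> / 4"] \<delta> obtain s0 where
      s0: "\<And>s. s \<ge> s0 \<Longrightarrow> norm (S s / real s - 0) < \<delta> / 4" by auto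
    have S_le: "S s \<le> \<delta> / 4 * real s + S s0" if "1 \<le> s" for s
    proof (cases "s0 \<le> s")
      case True
      have "S s / real s < \<delta> / 4"
        using s0[OF True] unfolding real_norm_def diff_0_right by linarith
      then have "S s \<le> \<delta> / 4 * real s" using that by (simp add: pos_divide_less_eq)
      then show ?thesis using S_nonneg[of s0] by simp
    next
      case False
      then have "S s \<le> S s0" by (intro S_mono) simp
      then show ?thesis using \<delta> by (simp add: add_increasing)
    qed
    \<comment> \<open>Collects the constants. The last one comes from \<open>ln y \<le> y\<close> at
      \<open>y = \<delta> / 8 * (1 / \<epsilon>)\<close>, doubled because \<open>\<epsilon>\<close>
      enters squared; the linear part then has coefficient \<open>\<delta> / 4\<close>. The
      threshold \<open>4 * C / \<delta>\<close> makes \<open>C\<close> cost another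
      \<open>\<delta> / 4\<close>, so the total stays at \<open>\<delta> / 2\<close>.\<close>
    define C where "C = \<bar>ln 2 + S s0 - 2 * ln (\<delta> / 8)\<bar>"
    have bound: "ln (real (n_mc s (r s) \<epsilon>)) / (real s + 1 / \<epsilon>) < \<delta>"
      if "1 \<le> s" "0 < \<epsilon>" "\<epsilon> < 1" "4 * C / \<delta> \<le> real s + 1 / \<epsilon>" for s \<epsilon>
    proof -
      define T where "T = real s + 1 / \<epsilon>"
      have T: "0 < T" using that by (simp add: T_def add_pos_pos)
      have "ln (\<delta> / 8 * (1 / \<epsilon>)) \<le> \<delta> / 8 * (1 / \<epsilon>)"
        using \<delta> that(2) ln_add_one_self_le_self2[of "\<delta> / 8 * (1 / \<epsilon>) - 1"] by simp
      then have ln_eps: "- ln \<epsilon> \<le> \<delta> / 8 * (1 / \<epsilon>) - ln (\<delta> / 8)"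
        using \<delta> that(2) by (subst (asm) ln_mult) (auto simp: ln_div)
      have "ln (real (n_mc s (r s) \<epsilon>)) \<le> ln (2 * exp (S s) / \<epsilon>\<^sup>2)"
        using n_ge_1[OF that(1,2,3)] n_le[OF that(1,2,3)] by (intro ln_mono) (auto simp: S_def)
      also have "\<dots> = ln 2 + S s - 2 * ln \<epsilon>"
        using that(2) by (simp add: ln_div ln_mult ln_realpow)
      also have "\<dots> \<le> \<delta> / 4 * T + (ln 2 + S s0 - 2 * ln (\<delta> / 8))"
      proof -
        have "\<delta> / 4 * T = \<delta> / 4 * real s + 2 * (\<delta> / 8 * (1 / \<epsilon>))" by (simp add: T_def distrib_left)
        then show ?thesis using S_le[OF that(1)] ln_eps by linarith
      qed
      also have "\<dots> \<le> \<delta> / 4 * T + C" unfolding C_def by simp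
      also have "C \<le> \<delta> / 4 * T"
        using that(4) \<delta> by (simp add: T_def[symmetric] field_simps)
      finally have "ln (real (n_mc s (r s) \<epsilon>)) \<le> \<delta> / 2 * T" by (simp add: mult.commute)
      also have "\<dots> < \<delta> * T" using \<delta> T by simp
      finally show ?thesis using T by (simp add: T_def[symmetric] pos_divide_less_eq)
    qed
    have nonneg: "0 \<le> ln (real (n_mc s (r s) \<epsilon>))" if "1 \<le> s" "0 < \<epsilon>" "\<epsilon> < 1" for s \<epsilon>
      using n_ge_1[OF that] by (intro ln_ge_zero) auto
    have "dist (case x of (s, \<epsilon>) \<Rightarrow> ln (real (n_mc s (r s) \<epsilon>)) / (real s + 1 / \<epsilon>)) 0 < \<delta>"
      if "x \<in> {1..} \<times> {0<..<1}" "4 * C / \<delta> \<le> (case x of (s, \<epsilon>) \<Rightarrow> real s + 1 / \<epsilon>)" for x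
      using that bound nonneg by (auto simp: dist_real_def)
    then show "\<forall>\<^sub>F x in inf (filtercomap (\<lambda>(s, \<epsilon>). real s + 1 / \<epsilon>) at_top) (principal ({1..} \<times> {0<..<1})).
        dist (case x of (s, \<epsilon>) \<Rightarrow> ln (real (n_mc s (r s) \<epsilon>)) / (real s + 1 / \<epsilon>)) 0 < \<delta>"
      unfolding eventually_inf_principal eventually_filtercomap_at_top_linorder by blast
  qed
qed

end

theorem theorem2:
  fixes \<alpha> :: real and \<gamma> :: "nat \<Rightarrow> real"
  assumes "1 < \<alpha>"
    and "\<And>j. 1 \<le> j \<Longrightarrow> 0 < \<gamma> j"
    and "\<And>j. 1 \<le> j \<Longrightarrow> \<gamma> (Suc j) \<le> \<gamma> j"
  shows "(strongly_polynomially_mc_tractable (finite_smoothness \<alpha> \<gamma>) \<longleftrightarrow>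
            summable (\<lambda>j. max (ln (\<gamma> (Suc j))) 0)) \<and>
         (polynomially_mc_tractable (finite_smoothness \<alpha> \<gamma>) \<longleftrightarrow>
            limsup (\<lambda>s. ereal (\<Sum>j=1..s. max (ln (\<gamma> j)) 0 / ln (real s))) < \<infinity>) \<and>
         (weakly_mc_tractable (finite_smoothness \<alpha> \<gamma>) \<longleftrightarrow>
            (\<lambda>s. \<Sum>j=1..s. max (ln (\<gamma> j)) 0 / real s) \<longlonglongrightarrow> 0)"
proof -
  interpret exponential_mc_bounds "finite_smoothness \<alpha> \<gamma>" "\<lambda>j. max (ln (\<gamma> j)) 0"
    by unfold_locales (use n_mc_finite_smoothness_bounds[where \<alpha> = \<alpha> and \<gamma> = \<gamma>, OF assms] in simp_all)
  show ?thesis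
    using strongly_polynomially_iff polynomially_iff weakly_iff
    by (simp only: S_def sum_divide_distrib simp_thms)
qed

end
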